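(* Let $\mathbb{T}$ be a complete Elgot monad on a distributive category $\mathbf{C}$, $\Sigma$ a strong functor such that each $T(X+\Sigma(-))$ has a final coalgebra $\mathrm{out}_X:T_\Sigma X\to T(X+\Sigma T_\Sigma X)$, and equip $\mathbb{T}_\Sigma$ with its strong monad structure and its complete Elgot structure (see context). Let $\mathrm{ext}=\mathrm{out}^{-1}\circ T\mathrm{inl}:T\to T_\Sigma$ and $\iota^{\mathbb{T}}_X=\mathrm{out}^{-1}\circ\eta\circ\mathrm{inr}\circ\Sigma\eta^{\nu}:\Sigma X\to T_\Sigma X$. Then for every complete Elgot monad $\mathbb{S}$, every strong natural transformation $\upsilon:\Sigma\to S$ and every complete Elgot monad morphism $\sigma:\mathbb{T}\to\mathbb{S}$, there is a unique complete Elgot monad morphism $\xi:\mathbb{T}_\Sigma\to\mathbb{S}$ with $\xi\circ\mathrm{ext}=\sigma$ and $\xi\circ\iota^{\mathbb{T}}=\upsilon$. Specifically, $\xi_X=\zeta_X^{\dagger}$ where $\zeta_X=[\eta\circ\mathrm{inl},S\mathrm{inr}\circ\upsilon]^{*}\circ\sigma\circ\mathrm{out}:T_\Sigma X\to S(X+T_\Sigma X)$.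
   Context: $\mathbf{C}$ is distributive (finite products and coproducts, with inverse distributivity map $\mathrm{dist}:X\times(Y+Z)\to X\times Y+X\times Z$). A strong monad is a Kleisli triple $(T,\eta,(-)^{*})$ with strength $\tau$ satisfying the usual laws; a strong functor has a strength $\rho_{X,Y}:X\times\Sigma Y\to\Sigma(X\times Y)$ with the usual laws, and a strong natural transformation $\alpha:F\to G$ satisfies $\rho\circ(\mathrm{id}\times\alpha)=\alpha\circ\rho$. A complete Elgot monad is a strong monad with an operator assigning to every $f:X\to T(Y+X)$ a morphism $f^{\dagger}:X\to TY$ satisfying: unfolding $[\eta,f^{\dagger}]^{*}f=f^{\dagger}$; naturality $g^{*}f^{\dagger}=([T\mathrm{inl}\circ g,\eta\mathrm{inr}]^{*}f)^{\dagger}$; dinaturality $([\eta\mathrm{inl},h]^{*}g)^{\dagger}=[\eta,([\eta\mathrm{inl},g]^{*}h)^{\dagger}]^{*}g$ ($g:X\to T(Y+Z)$, $h:Z\to T(Y+X)$); codiagonal $(T[\mathrm{id},\mathrm{inr}]g)^{\dagger}=(g^{\dagger})^{\dagger}$ ($g:X\to T((Y+X)+X)$); uniformity: $f h=T(\mathrm{id}+h)g$ implies $f^{\dagger}h=g^{\dagger}$; strength compatibility $\tau(\mathrm{id}\times f^{\dagger})=(T\mathrm{dist}\circ\tau\circ(\mathrm{id}\times f))^{\dagger}$. A complete Elgot monad morphism $\xi:\mathbb{R}\to\mathbb{S}$ is a natural transformation with $\xi\eta=\eta$, $\xi f^{*}=(\xi f)^{*}\xi$, $\xi\tau=\tau(\mathrm{id}\times\xi)$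 and $(\xi g)^{\dagger}=\xi g^{\dagger}$. The strong monad $\mathbb{T}_\Sigma$: unit $\eta^{\nu}$ with $\mathrm{out}\circ\eta^{\nu}=\eta\circ\mathrm{inl}$; $f^{\ddagger}$ the unique solution of $\mathrm{out}\circ f^{\ddagger}=[\mathrm{out}\circ f,\eta\circ\mathrm{inr}\circ\Sigma f^{\ddagger}]^{*}\circ\mathrm{out}$; strength $\tau^{\nu}$ the unique solution of $\mathrm{out}\circ\tau^{\nu}=T(\mathrm{id}+\Sigma\tau^{\nu})\circ T((\mathrm{id}+\rho)\circ\mathrm{dist})\circ\tau\circ(\mathrm{id}\times\mathrm{out})$. Its complete Elgot structure is the unique one such that for $f:X\to T_\Sigma(Y+X)$, $g:X\to T(Y+X)$ with $\mathrm{out}\circ f=T\mathrm{inl}\circ g$ one has $\mathrm{out}\circ f^{\dagger}=T\mathrm{inl}\circ g^{\dagger}$. *)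

theory Defs
  imports Main
begin

text \<open>Every element of the type \<open>'o\<close> is an object. The arrows form a set and carry their domain and
  codomain. Products, coproducts, terminal and initial object are chosen structure.\<close>

record ('o, 'm) cat =
  Arr :: "'m set"
  Dom :: "'m \<Rightarrow> 'o"
  Cod :: "'m \<Rightarrow> 'o"
  Id :: "'o \<Rightarrow> 'm"
  Comp :: "'m \<Rightarrow> 'm \<Rightarrow> 'm"  (infixr \<open>\<cdot>\<index>\<close> 70)

record ('o, 'm) bicart = "('o, 'm) cat" +
  One :: 'o
  Prod :: "'o \<Rightarrow> 'o \<Rightarrow> 'o"  (infixr \<open>\<otimes>\<index>\<close> 75)
  Fst :: "'o \<Rightarrow> 'o \<Rightarrow> 'm"
  Snd :: "'o \<Rightarrow> 'o \<Rightarrow> 'm"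
  Pairing :: "'m \<Rightarrow> 'm \<Rightarrow> 'm"  (\<open>\<langle>_,/ _\<rangle>\<index>\<close>)
  Zero :: 'o
  Coprod :: "'o \<Rightarrow> 'o \<Rightarrow> 'o"  (infixr \<open>\<oplus>\<index>\<close> 72)
  Inl :: "'o \<Rightarrow> 'o \<Rightarrow> 'm"
  Inr :: "'o \<Rightarrow> 'o \<Rightarrow> 'm"
  Copairing :: "'m \<Rightarrow> 'm \<Rightarrow> 'm"  (\<open>\<lbrace>_,/ _\<rbrace>\<index>\<close>)

definition hom :: "('o, 'm, 'x) cat_scheme \<Rightarrow> 'o \<Rightarrow> 'o \<Rightarrow> 'm set" where
  "hom C X Y = {f \<in> Arr C. Dom C f = X \<and> Cod C f = Y}"

definition is_inverse :: "('o, 'm, 'x) cat_scheme \<Rightarrow> 'm \<Rightarrow> 'm \<Rightarrow> bool" where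
  "is_inverse C f g \<longleftrightarrow> g \<in> hom C (Cod C f) (Dom C f) \<and>
     g \<cdot> f = Id C (Dom C f) \<and> f \<cdot> g = Id C (Cod C f)" for C (structure)

definition is_iso :: "('o, 'm, 'x) cat_scheme \<Rightarrow> 'm \<Rightarrow> bool" where
  "is_iso C f \<longleftrightarrow> f \<in> Arr C \<and> (\<exists>g. is_inverse C f g)"

definition inv_arr :: "('o, 'm, 'x) cat_scheme \<Rightarrow> 'm \<Rightarrow> 'm" where
  "inv_arr C f = (THE g. is_inverse C f g)"

definition prod_arr :: "('o, 'm) bicart \<Rightarrow> 'm \<Rightarrow> 'm \<Rightarrow> 'm"  (infixr \<open>\<otimes>\<^sub>a\<index>\<close> 75) where
  "f \<otimes>\<^sub>a g = \<langle>f \<cdot> Fst C (Dom C f) (Dom C g), g \<cdot> Snd C (Dom C f) (Dom C g)\<rangle>" for C (structure)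

definition coprod_arr :: "('o, 'm) bicart \<Rightarrow> 'm \<Rightarrow> 'm \<Rightarrow> 'm"  (infixr \<open>\<oplus>\<^sub>a\<index>\<close> 72) where
  "f \<oplus>\<^sub>a g = \<lbrace>Inl C (Cod C f) (Cod C g) \<cdot> f, Inr C (Cod C f) (Cod C g) \<cdot> g\<rbrace>" for C (structure)

definition assoc_arr :: "('o, 'm) bicart \<Rightarrow> 'o \<Rightarrow> 'o \<Rightarrow> 'o \<Rightarrow> 'm" where
  "assoc_arr C X Y Z =
     \<langle>Fst C X Y \<cdot> Fst C (X \<otimes> Y) Z, \<langle>Snd C X Y \<cdot> Fst C (X \<otimes> Y) Z, Snd C (X \<otimes> Y) Z\<rangle>\<rangle>"
  for C (structure)

definition codist :: "('o, 'm) bicart \<Rightarrow> 'o \<Rightarrow> 'o \<Rightarrow> 'o \<Rightarrow> 'm" where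
  "codist C X Y Z = \<lbrace>Id C X \<otimes>\<^sub>a Inl C Y Z, Id C X \<otimes>\<^sub>a Inr C Y Z\<rbrace>" for C (structure)

definition dist :: "('o, 'm) bicart \<Rightarrow> 'o \<Rightarrow> 'o \<Rightarrow> 'o \<Rightarrow> 'm" where
  "dist C X Y Z = inv_arr C (codist C X Y Z)"

locale category =
  fixes C :: "('o, 'm, 'x) cat_scheme" (structure)
  assumes Id_hom: "Id C X \<in> hom C X X"
    and Comp_hom: "f \<in> hom C X Y \<Longrightarrow> g \<in> hom C Y Z \<Longrightarrow> g \<cdot> f \<in> hom C X Z"
    and Id_left: "f \<in> hom C X Y \<Longrightarrow> Id C Y \<cdot> f = f"
    and Id_right: "f \<in> hom C X Y \<Longrightarrow> f \<cdot> Id C X = f"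
    and Comp_assoc: "f \<in> hom C W X \<Longrightarrow> g \<in> hom C X Y \<Longrightarrow> h \<in> hom C Y Z \<Longrightarrow>
      (h \<cdot> g) \<cdot> f = h \<cdot> (g \<cdot> f)"

locale distributive_category = category C
  for C :: "('o, 'm) bicart" (structure) +
  assumes One_terminal: "\<exists>!f. f \<in> hom C X (One C)"
    and Fst_hom: "Fst C X Y \<in> hom C (X \<otimes> Y) X"
    and Snd_hom: "Snd C X Y \<in> hom C (X \<otimes> Y) Y"
    and Pairing_hom: "f \<in> hom C Z X \<Longrightarrow> g \<in> hom C Z Y \<Longrightarrow> \<langle>f, g\<rangle> \<in> hom C Z (X \<otimes> Y)"
    and Fst_Pairing: "f \<in> hom C Z X \<Longrightarrow> g \<in> hom C Z Y \<Longrightarrow> Fst C X Y \<cdot> \<langle>f, g\<rangle> = f"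
    and Snd_Pairing: "f \<in> hom C Z X \<Longrightarrow> g \<in> hom C Z Y \<Longrightarrow> Snd C X Y \<cdot> \<langle>f, g\<rangle> = g"
    and Pairing_unique: "h \<in> hom C Z (X \<otimes> Y) \<Longrightarrow> \<langle>Fst C X Y \<cdot> h, Snd C X Y \<cdot> h\<rangle> = h"
    and Zero_initial: "\<exists>!f. f \<in> hom C (Zero C) X"
    and Inl_hom: "Inl C X Y \<in> hom C X (X \<oplus> Y)"
    and Inr_hom: "Inr C X Y \<in> hom C Y (X \<oplus> Y)"
    and Copairing_hom: "f \<in> hom C X Z \<Longrightarrow> g \<in> hom C Y Z \<Longrightarrow> \<lbrace>f, g\<rbrace> \<in> hom C (X \<oplus> Y) Z"
    and Copairing_Inl: "f \<in> hom C X Z \<Longrightarrow> g \<in> hom C Y Z \<Longrightarrow> \<lbrace>f, g\<rbrace> \<cdot> Inl C X Y = f"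
    and Copairing_Inr: "f \<in> hom C X Z \<Longrightarrow> g \<in> hom C Y Z \<Longrightarrow> \<lbrace>f, g\<rbrace> \<cdot> Inr C X Y = g"
    and Copairing_unique: "h \<in> hom C (X \<oplus> Y) Z \<Longrightarrow> \<lbrace>h \<cdot> Inl C X Y, h \<cdot> Inr C X Y\<rbrace> = h"
    and codist_iso: "is_iso C (codist C X Y Z)"

record ('o, 'm) func =
  fob :: "'o \<Rightarrow> 'o"
  fmap :: "'m \<Rightarrow> 'm"

record ('o, 'm) sfunc = "('o, 'm) func" +
  fstr :: "'o \<Rightarrow> 'o \<Rightarrow> 'm"

locale endofunctor = category C
  for C :: "('o, 'm, 'x) cat_scheme" (structure) +
  fixes F :: "('o, 'm, 'y) func_scheme"
  assumes fmap_hom: "f \<in> hom C X Y \<Longrightarrow> fmap F f \<in> hom C (fob F X) (fob F Y)"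
    and fmap_Id: "fmap F (Id C X) = Id C (fob F X)"
    and fmap_Comp: "f \<in> hom C X Y \<Longrightarrow> g \<in> hom C Y Z \<Longrightarrow> fmap F (g \<cdot> f) = fmap F g \<cdot> fmap F f"

locale strong_functor = distributive_category C + endofunctor C F
  for C :: "('o, 'm) bicart" (structure) and F :: "('o, 'm) sfunc" +
  assumes fstr_hom: "fstr F X Y \<in> hom C (X \<otimes> fob F Y) (fob F (X \<otimes> Y))"
    and fstr_natural: "f \<in> hom C X X' \<Longrightarrow> g \<in> hom C Y Y' \<Longrightarrow>
      fstr F X' Y' \<cdot> (f \<otimes>\<^sub>a fmap F g) = fmap F (f \<otimes>\<^sub>a g) \<cdot> fstr F X Y"
    and fstr_unit: "fmap F (Snd C (One C) X) \<cdot> fstr F (One C) X = Snd C (One C) (fob F X)"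
    and fstr_assoc: "fmap F (assoc_arr C X Y Z) \<cdot> fstr F (X \<otimes> Y) Z =
      fstr F X (Y \<otimes> Z) \<cdot> (Id C X \<otimes>\<^sub>a fstr F Y Z) \<cdot> assoc_arr C X Y (fob F Z)"

definition strong_nat_trans ::
  "('o, 'm) bicart \<Rightarrow> ('o, 'm) sfunc \<Rightarrow> ('o, 'm) sfunc \<Rightarrow> ('o \<Rightarrow> 'm) \<Rightarrow> bool" where
  "strong_nat_trans C F G \<alpha> \<longleftrightarrow>
     (\<forall>X. \<alpha> X \<in> hom C (fob F X) (fob G X)) \<and>
     (\<forall>X Y f. f \<in> hom C X Y \<longrightarrow> fmap G f \<cdot> \<alpha> X = \<alpha> Y \<cdot> fmap F f) \<and>
     (\<forall>X Y. fstr G X Y \<cdot> (Id C X \<otimes>\<^sub>a \<alpha> Y) = \<alpha> (X \<otimes> Y) \<cdot> fstr F X Y)"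
  for C (structure)

text \<open>The object map \<open>tob T\<close> need not be injective, so the type \<open>X \<rightarrow> T Y\<close> of a Kleisli arrow is not
  determined by its domain and codomain as an arrow. Kleisli lifting and iteration therefore take
  the objects explicitly: \<open>klift T X Y f\<close> is \<open>f\<^sup>*\<close> for \<open>f : X \<rightarrow> T Y\<close>, and \<open>dagger T X Y f\<close> is the
  iteration of \<open>f : X \<rightarrow> T (Y + X)\<close>.\<close>

record ('o, 'm) monad =
  tob :: "'o \<Rightarrow> 'o"
  eta :: "'o \<Rightarrow> 'm"
  klift :: "'o \<Rightarrow> 'o \<Rightarrow> 'm \<Rightarrow> 'm"
  tstr :: "'o \<Rightarrow> 'o \<Rightarrow> 'm"

record ('o, 'm) elgot = "('o, 'm) monad" +
  dagger :: "'o \<Rightarrow> 'o \<Rightarrow> 'm \<Rightarrow> 'm"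

definition tmap :: "('o, 'm) bicart \<Rightarrow> ('o, 'm, 'y) monad_scheme \<Rightarrow> 'm \<Rightarrow> 'm" where
  "tmap C T f = klift T (Dom C f) (Cod C f) (eta T (Cod C f) \<cdot> f)" for C (structure)

definition functor_of :: "('o, 'm) bicart \<Rightarrow> ('o, 'm, 'y) monad_scheme \<Rightarrow> ('o, 'm) sfunc" where
  "functor_of C T = \<lparr>fob = tob T, fmap = tmap C T, fstr = tstr T\<rparr>"

locale strong_monad = strong_functor C "functor_of C T"
  for C :: "('o, 'm) bicart" (structure) and T :: "('o, 'm, 'y) monad_scheme" +
  assumes eta_hom: "eta T X \<in> hom C X (tob T X)"
    and klift_hom: "f \<in> hom C X (tob T Y) \<Longrightarrow> klift T X Y f \<in> hom C (tob T X) (tob T Y)"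
    and klift_eta: "klift T X X (eta T X) = Id C (tob T X)"
    and klift_Comp_eta: "f \<in> hom C X (tob T Y) \<Longrightarrow> klift T X Y f \<cdot> eta T X = f"
    and klift_klift: "f \<in> hom C Y (tob T Z) \<Longrightarrow> g \<in> hom C X (tob T Y) \<Longrightarrow>
      klift T X Z (klift T Y Z f \<cdot> g) = klift T Y Z f \<cdot> klift T X Y g"
    and tstr_eta: "tstr T X Y \<cdot> (Id C X \<otimes>\<^sub>a eta T Y) = eta T (X \<otimes> Y)"
    and tstr_klift: "f \<in> hom C Y (tob T Z) \<Longrightarrow>
      tstr T X Z \<cdot> (Id C X \<otimes>\<^sub>a klift T Y Z f) =
      klift T (X \<otimes> Y) (X \<otimes> Z) (tstr T X Z \<cdot> (Id C X \<otimes>\<^sub>a f)) \<cdot> tstr T X Y"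

locale complete_elgot_monad = strong_monad C T
  for C :: "('o, 'm) bicart" (structure) and T :: "('o, 'm) elgot" +
  assumes dagger_hom: "f \<in> hom C X (tob T (Y \<oplus> X)) \<Longrightarrow> dagger T X Y f \<in> hom C X (tob T Y)"
    and unfolding_law: "f \<in> hom C X (tob T (Y \<oplus> X)) \<Longrightarrow>
      klift T (Y \<oplus> X) Y \<lbrace>eta T Y, dagger T X Y f\<rbrace> \<cdot> f = dagger T X Y f"
    and naturality_law: "f \<in> hom C X (tob T (Y \<oplus> X)) \<Longrightarrow> g \<in> hom C Y (tob T Z) \<Longrightarrow>
      klift T Y Z g \<cdot> dagger T X Y f =
      dagger T X Z (klift T (Y \<oplus> X) (Z \<oplus> X)
        \<lbrace>tmap C T (Inl C Z X) \<cdot> g, eta T (Z \<oplus> X) \<cdot> Inr C Z X\<rbrace> \<cdot> f)"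
    and dinaturality_law: "g \<in> hom C X (tob T (Y \<oplus> Z)) \<Longrightarrow> h \<in> hom C Z (tob T (Y \<oplus> X)) \<Longrightarrow>
      dagger T X Y (klift T (Y \<oplus> Z) (Y \<oplus> X) \<lbrace>eta T (Y \<oplus> X) \<cdot> Inl C Y X, h\<rbrace> \<cdot> g) =
      klift T (Y \<oplus> Z) Y \<lbrace>eta T Y,
        dagger T Z Y (klift T (Y \<oplus> X) (Y \<oplus> Z) \<lbrace>eta T (Y \<oplus> Z) \<cdot> Inl C Y Z, g\<rbrace> \<cdot> h)\<rbrace> \<cdot> g"
    and codiagonal_law: "g \<in> hom C X (tob T ((Y \<oplus> X) \<oplus> X)) \<Longrightarrow>
      dagger T X Y (tmap C T \<lbrace>Id C (Y \<oplus> X), Inr C Y X\<rbrace> \<cdot> g) =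
      dagger T X Y (dagger T X (Y \<oplus> X) g)"
    and uniformity_law: "f \<in> hom C X (tob T (Y \<oplus> X)) \<Longrightarrow> g \<in> hom C Z (tob T (Y \<oplus> Z)) \<Longrightarrow>
      h \<in> hom C Z X \<Longrightarrow> f \<cdot> h = tmap C T (Id C Y \<oplus>\<^sub>a h) \<cdot> g \<Longrightarrow>
      dagger T X Y f \<cdot> h = dagger T Z Y g"
    and strength_law: "f \<in> hom C X (tob T (Y \<oplus> X)) \<Longrightarrow>
      tstr T W Y \<cdot> (Id C W \<otimes>\<^sub>a dagger T X Y f) =
      dagger T (W \<otimes> X) (W \<otimes> Y)
        (tmap C T (dist C W Y X) \<cdot> tstr T W (Y \<oplus> X) \<cdot> (Id C W \<otimes>\<^sub>a f))"

definition elgot_morphism ::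
  "('o, 'm) bicart \<Rightarrow> ('o, 'm) elgot \<Rightarrow> ('o, 'm) elgot \<Rightarrow> ('o \<Rightarrow> 'm) \<Rightarrow> bool" where
  "elgot_morphism C R S \<xi> \<longleftrightarrow>
     strong_nat_trans C (functor_of C R) (functor_of C S) \<xi> \<and>
     (\<forall>X. \<xi> X \<cdot> eta R X = eta S X) \<and>
     (\<forall>X Y f. f \<in> hom C X (tob R Y) \<longrightarrow>
        \<xi> Y \<cdot> klift R X Y f = klift S X Y (\<xi> Y \<cdot> f) \<cdot> \<xi> X) \<and>
     (\<forall>X Y g. g \<in> hom C X (tob R (Y \<oplus> X)) \<longrightarrow>
        dagger S X Y (\<xi> (Y \<oplus> X) \<cdot> g) = \<xi> Y \<cdot> dagger R X Y g)"
  for C (structure)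

definition final_coalgebra ::
  "('o, 'm, 'x) cat_scheme \<Rightarrow> ('o, 'm, 'y) func_scheme \<Rightarrow> 'o \<Rightarrow> 'm \<Rightarrow> bool" where
  "final_coalgebra C G A a \<longleftrightarrow> a \<in> hom C A (fob G A) \<and>
     (\<forall>Z c. c \<in> hom C Z (fob G Z) \<longrightarrow> (\<exists>!h. h \<in> hom C Z A \<and> a \<cdot> h = fmap G h \<cdot> c))"
  for C (structure)

text \<open>The functor \<open>T (X + \<Sigma> (-))\<close>.\<close>

definition resump_functor ::
  "('o, 'm) bicart \<Rightarrow> ('o, 'm, 'y) monad_scheme \<Rightarrow> ('o, 'm) sfunc \<Rightarrow> 'o \<Rightarrow> ('o, 'm) func" where
  "resump_functor C T \<Sigma> X =
     \<lparr>fob = (\<lambda>Z. tob T (X \<oplus> fob \<Sigma> Z)), fmap = (\<lambda>h. tmap C T (Id C X \<oplus>\<^sub>a fmap \<Sigma> h))\<rparr>"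
  for C (structure)

text \<open>In the following, \<open>V X\<close> is the carrier \<open>T\<^sub>\<Sigma> X\<close> of the final coalgebra
  \<open>out X : V X \<rightarrow> T (X + \<Sigma> (V X))\<close>.\<close>

definition resump_eta ::
  "('o, 'm) bicart \<Rightarrow> ('o, 'm, 'y) monad_scheme \<Rightarrow> ('o, 'm) sfunc \<Rightarrow> ('o \<Rightarrow> 'o) \<Rightarrow> ('o \<Rightarrow> 'm) \<Rightarrow>
   'o \<Rightarrow> 'm" where
  "resump_eta C T \<Sigma> V out X = (THE e. e \<in> hom C X (V X) \<and>
     out X \<cdot> e = eta T (X \<oplus> fob \<Sigma> (V X)) \<cdot> Inl C X (fob \<Sigma> (V X)))"
  for C (structure)

definition resump_klift ::
  "('o, 'm) bicart \<Rightarrow> ('o, 'm, 'y) monad_scheme \<Rightarrow> ('o, 'm) sfunc \<Rightarrow> ('o \<Rightarrow> 'o) \<Rightarrow> ('o \<Rightarrow> 'm) \<Rightarrow>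
   'o \<Rightarrow> 'o \<Rightarrow> 'm \<Rightarrow> 'm" where
  "resump_klift C T \<Sigma> V out X Y f = (THE h. h \<in> hom C (V X) (V Y) \<and>
     out Y \<cdot> h = klift T (X \<oplus> fob \<Sigma> (V X)) (Y \<oplus> fob \<Sigma> (V Y))
       \<lbrace>out Y \<cdot> f, eta T (Y \<oplus> fob \<Sigma> (V Y)) \<cdot> Inr C Y (fob \<Sigma> (V Y)) \<cdot> fmap \<Sigma> h\<rbrace> \<cdot> out X)"
  for C (structure)

definition resump_str ::
  "('o, 'm) bicart \<Rightarrow> ('o, 'm, 'y) monad_scheme \<Rightarrow> ('o, 'm) sfunc \<Rightarrow> ('o \<Rightarrow> 'o) \<Rightarrow> ('o \<Rightarrow> 'm) \<Rightarrow>
   'o \<Rightarrow> 'o \<Rightarrow> 'm" where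
  "resump_str C T \<Sigma> V out X Y = (THE t. t \<in> hom C (X \<otimes> V Y) (V (X \<otimes> Y)) \<and>
     out (X \<otimes> Y) \<cdot> t =
       tmap C T (Id C (X \<otimes> Y) \<oplus>\<^sub>a fmap \<Sigma> t) \<cdot>
       tmap C T ((Id C (X \<otimes> Y) \<oplus>\<^sub>a fstr \<Sigma> X (V Y)) \<cdot> dist C X Y (fob \<Sigma> (V Y))) \<cdot>
       tstr T X (Y \<oplus> fob \<Sigma> (V Y)) \<cdot> (Id C X \<otimes>\<^sub>a out Y))"
  for C (structure)

text \<open>The strong monad \<open>T\<^sub>\<Sigma>\<close> together with a candidate iteration operator \<open>d\<close>.\<close>

definition resump_elgot ::
  "('o, 'm) bicart \<Rightarrow> ('o, 'm, 'y) monad_scheme \<Rightarrow> ('o, 'm) sfunc \<Rightarrow> ('o \<Rightarrow> 'o) \<Rightarrow> ('o \<Rightarrow> 'm) \<Rightarrow>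
   ('o \<Rightarrow> 'o \<Rightarrow> 'm \<Rightarrow> 'm) \<Rightarrow> ('o, 'm) elgot" where
  "resump_elgot C T \<Sigma> V out d =
     \<lparr>tob = V, eta = resump_eta C T \<Sigma> V out, klift = resump_klift C T \<Sigma> V out,
      tstr = resump_str C T \<Sigma> V out, dagger = d\<rparr>"

text \<open>The property that determines the iteration operator \<open>d\<close> of \<open>T\<^sub>\<Sigma>\<close> on all arrows
  \<open>X \<rightarrow> T\<^sub>\<Sigma> (Y + X)\<close>: it makes \<open>T\<^sub>\<Sigma>\<close> a complete Elgot monad and extends the iteration operator
  of \<open>T\<close>.\<close>

definition resump_iteration ::
  "('o, 'm) bicart \<Rightarrow> ('o, 'm) elgot \<Rightarrow> ('o, 'm) sfunc \<Rightarrow> ('o \<Rightarrow> 'o) \<Rightarrow> ('o \<Rightarrow> 'm) \<Rightarrow>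
   ('o \<Rightarrow> 'o \<Rightarrow> 'm \<Rightarrow> 'm) \<Rightarrow> bool" where
  "resump_iteration C T \<Sigma> V out d \<longleftrightarrow>
     complete_elgot_monad C (resump_elgot C T \<Sigma> V out d) \<and>
     (\<forall>X Y f g. f \<in> hom C X (V (Y \<oplus> X)) \<longrightarrow> g \<in> hom C X (tob T (Y \<oplus> X)) \<longrightarrow>
        out (Y \<oplus> X) \<cdot> f = tmap C T (Inl C (Y \<oplus> X) (fob \<Sigma> (V (Y \<oplus> X)))) \<cdot> g \<longrightarrow>
        out Y \<cdot> d X Y f = tmap C T (Inl C Y (fob \<Sigma> (V Y))) \<cdot> dagger T X Y g)"
  for C (structure)

definition resump_ext ::
  "('o, 'm) bicart \<Rightarrow> ('o, 'm, 'y) monad_scheme \<Rightarrow> ('o, 'm) sfunc \<Rightarrow> ('o \<Rightarrow> 'o) \<Rightarrow> ('o \<Rightarrow> 'm) \<Rightarrow>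
   'o \<Rightarrow> 'm" where
  "resump_ext C T \<Sigma> V out X = inv_arr C (out X) \<cdot> tmap C T (Inl C X (fob \<Sigma> (V X)))"
  for C (structure)

definition resump_iota ::
  "('o, 'm) bicart \<Rightarrow> ('o, 'm, 'y) monad_scheme \<Rightarrow> ('o, 'm) sfunc \<Rightarrow> ('o \<Rightarrow> 'o) \<Rightarrow> ('o \<Rightarrow> 'm) \<Rightarrow>
   'o \<Rightarrow> 'm" where
  "resump_iota C T \<Sigma> V out X =
     inv_arr C (out X) \<cdot> eta T (X \<oplus> fob \<Sigma> (V X)) \<cdot> Inr C X (fob \<Sigma> (V X)) \<cdot>
     fmap \<Sigma> (resump_eta C T \<Sigma> V out X)"
  for C (structure)

definition resump_zeta ::
  "('o, 'm) bicart \<Rightarrow> ('o, 'm) sfunc \<Rightarrow> ('o \<Rightarrow> 'o) \<Rightarrow> ('o \<Rightarrow> 'm) \<Rightarrow>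
   ('o, 'm) elgot \<Rightarrow> ('o \<Rightarrow> 'm) \<Rightarrow> ('o \<Rightarrow> 'm) \<Rightarrow> 'o \<Rightarrow> 'm" where
  "resump_zeta C \<Sigma> V out S \<upsilon> \<sigma> X =
     klift S (X \<oplus> fob \<Sigma> (V X)) (X \<oplus> V X)
       \<lbrace>eta S (X \<oplus> V X) \<cdot> Inl C X (V X), tmap C S (Inr C X (V X)) \<cdot> \<upsilon> (V X)\<rbrace> \<cdot>
     \<sigma> (X \<oplus> fob \<Sigma> (V X)) \<cdot> out X"
  for C (structure)

end

theory Submission
  imports Defs
begin

text \<open>Uniqueness: \<open>\<zeta>\<close> for \<open>T\<^sub>\<Sigma>\<close> itself, with \<open>ext\<close> and \<open>\<iota>\<close> in place of \<open>\<sigma>\<close> and \<open>\<upsilon>\<close>, has the iteration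
  \<open>id\<close>: by unfolding, the iteration is an endomorphism of the final coalgebra. A morphism \<open>\<xi>\<close>
  preserves iteration and sends this arrow to \<open>\<zeta>\<close>, so \<open>\<xi> = \<zeta>\<^sup>\<dagger>\<close>.

  Existence: let \<open>\<xi> = \<zeta>\<^sup>\<dagger>\<close>. The laws for Kleisli lifting, strength and iteration are equations
  between iterations, obtained by uniformity along a map into a final coalgebra: along
  \<open>[f\<^sup>\<ddagger>, id]\<close> for Kleisli lifting, where the system on \<open>T\<^sub>\<Sigma> X + T\<^sub>\<Sigma> Y\<close> is solved componentwise, and along \<open>\<tau>\<^sup>\<nu>\<close> for the strength. For iteration, naturality
  and codiagonal reduce \<open>g : X \<rightarrow> T\<^sub>\<Sigma> (Y + X)\<close> to one whose recursive calls are all guarded by \<open>\<Sigma>\<close>. Then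
  \<open>[\<eta>, g\<^sup>\<dagger>]\<^sup>\<ddagger>\<close> is a coalgebra morphism, uniformity along it expresses \<open>\<xi> g\<^sup>\<dagger>\<close> as an iteration over
  \<open>T\<^sub>\<Sigma> (Y + X)\<close>, and dinaturality turns this iteration into one of \<open>\<xi> g\<close>.\<close>

section \<open>Distributive categories\<close>

text \<open>Types are handled through \<open>Arr\<close>, \<open>Dom\<close> and \<open>Cod\<close>
  rather than \<open>hom\<close>, so that the simplifier computes the type of a composite from its
  parts.\<close>

lemma hom_iff: "f \<in> hom C X Y \<longleftrightarrow> f \<in> Arr C \<and> Dom C f = X \<and> Cod C f = Y"
  by (simp add: hom_def)

context category
begin

lemma Id_typing [simp]: "Id C X \<in> Arr C" "Dom C (Id C X) = X" "Cod C (Id C X) = X"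
  using Id_hom by (auto simp: hom_iff)

lemma Comp_typing [simp]:
  assumes "f \<in> Arr C" "g \<in> Arr C" "Cod C f = Dom C g"
  shows "g \<cdot> f \<in> Arr C" "Dom C (g \<cdot> f) = Dom C f" "Cod C (g \<cdot> f) = Cod C g"
  using Comp_hom[of f "Dom C f" "Dom C g" g "Cod C g"] assms by (auto simp: hom_iff)

lemma Id_Comp [simp]: "f \<in> Arr C \<Longrightarrow> Cod C f = X \<Longrightarrow> Id C X \<cdot> f = f"
  using Id_left by (auto simp: hom_iff)

lemma Comp_Id [simp]: "f \<in> Arr C \<Longrightarrow> Dom C f = X \<Longrightarrow> f \<cdot> Id C X = f"
  using Id_right by (auto simp: hom_iff)

lemma Comp_assoc' [simp]:
  "f \<in> Arr C \<Longrightarrow> g \<in> Arr C \<Longrightarrow> h \<in> Arr C \<Longrightarrow> Cod C f = Dom C g \<Longrightarrow> Cod C g = Dom C h \<Longrightarrow>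
    (h \<cdot> g) \<cdot> f = h \<cdot> (g \<cdot> f)"
  using Comp_assoc by (auto simp: hom_iff)

text \<open>Composites are normalized to the right, where an equation for \<open>a \<cdot> b\<close>
  stops matching once another arrow stands to the right of \<open>b\<close>. This form restores
  it.\<close>

lemma Comp_reassoc:
  assumes "a \<cdot> b = c" "a \<in> Arr C" "b \<in> Arr C" "Dom C a = Cod C b" "h \<in> Arr C" "Cod C h = Dom C b"
  shows "a \<cdot> (b \<cdot> h) = c \<cdot> h"
  using Comp_assoc'[of h b a] assms by simp

lemma inverse_unique:
  assumes "f \<in> hom C X Y" "is_inverse C f g" "is_inverse C f h"
  shows "g = h"
proof -
  have "g = g \<cdot> (f \<cdot> h)" using assms by (simp add: is_inverse_def hom_iff)
  also have "\<dots> = h"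
    using assms Comp_assoc'[of h f g] by (simp add: is_inverse_def hom_iff)
  finally show ?thesis .
qed

lemma inv_arr_inverse:
  assumes "f \<in> hom C X Y" "is_iso C f"
  shows "is_inverse C f (inv_arr C f)"
proof -
  obtain g where g: "is_inverse C f g" using assms by (auto simp: is_iso_def)
  then have "inv_arr C f = g"
    unfolding inv_arr_def using inverse_unique[OF assms(1)] by blast
  with g show ?thesis by simp
qed

end

section \<open>Products, coproducts and the distributivity isomorphism\<close>

context distributive_category
begin

lemma prod_typing [simp]:
  "Fst C X Y \<in> Arr C" "Dom C (Fst C X Y) = X \<otimes> Y" "Cod C (Fst C X Y) = X"
  "Snd C X Y \<in> Arr C" "Dom C (Snd C X Y) = X \<otimes> Y" "Cod C (Snd C X Y) = Y"
  using Fst_hom Snd_hom by (auto simp: hom_iff)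

lemma Pairing_typing [simp]:
  assumes "f \<in> Arr C" "g \<in> Arr C" "Dom C f = Dom C g"
  shows "\<langle>f, g\<rangle> \<in> Arr C" "Dom C \<langle>f, g\<rangle> = Dom C g" "Cod C \<langle>f, g\<rangle> = Cod C f \<otimes> Cod C g"
  using Pairing_hom[of f "Dom C f" "Cod C f" g "Cod C g"] assms by (auto simp: hom_iff)

lemma proj_Pairing [simp]:
  assumes "f \<in> Arr C" "g \<in> Arr C" "Dom C f = Dom C g" "Cod C f = X" "Cod C g = Y"
  shows "Fst C X Y \<cdot> \<langle>f, g\<rangle> = f" "Snd C X Y \<cdot> \<langle>f, g\<rangle> = g"
  using Fst_Pairing[of f "Dom C f" X g Y] Snd_Pairing[of f "Dom C f" X g Y] assms
  by (auto simp: hom_iff)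

lemma Pairing_eqI:
  assumes "h \<in> hom C Z (X \<otimes> Y)" "k \<in> hom C Z (X \<otimes> Y)"
    and "Fst C X Y \<cdot> h = Fst C X Y \<cdot> k" "Snd C X Y \<cdot> h = Snd C X Y \<cdot> k"
  shows "h = k"
  using Pairing_unique[OF assms(1)] Pairing_unique[OF assms(2)] assms(3,4) by metis

lemma Pairing_Comp [simp]:
  assumes "f \<in> Arr C" "g \<in> Arr C" "Dom C f = Dom C g" "h \<in> Arr C" "Cod C h = Dom C g"
  shows "\<langle>f, g\<rangle> \<cdot> h = \<langle>f \<cdot> h, g \<cdot> h\<rangle>"
proof (rule Pairing_eqI)
  show "\<langle>f, g\<rangle> \<cdot> h \<in> hom C (Dom C h) (Cod C f \<otimes> Cod C g)"
    "\<langle>f \<cdot> h, g \<cdot> h\<rangle> \<in> hom C (Dom C h) (Cod C f \<otimes> Cod C g)"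
    using assms by (auto simp: hom_iff)
qed (use assms in \<open>simp_all add: Comp_reassoc[OF proj_Pairing(1)] Comp_reassoc[OF proj_Pairing(2)]\<close>)

lemma coprod_typing [simp]:
  "Inl C X Y \<in> Arr C" "Dom C (Inl C X Y) = X" "Cod C (Inl C X Y) = X \<oplus> Y"
  "Inr C X Y \<in> Arr C" "Dom C (Inr C X Y) = Y" "Cod C (Inr C X Y) = X \<oplus> Y"
  using Inl_hom Inr_hom by (auto simp: hom_iff)

lemma Copairing_typing [simp]:
  assumes "f \<in> Arr C" "g \<in> Arr C" "Cod C f = Cod C g"
  shows "\<lbrace>f, g\<rbrace> \<in> Arr C" "Dom C \<lbrace>f, g\<rbrace> = Dom C f \<oplus> Dom C g" "Cod C \<lbrace>f, g\<rbrace> = Cod C g"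
  using Copairing_hom[of f "Dom C f" "Cod C f" g "Dom C g"] assms by (auto simp: hom_iff)

lemma Copairing_inj [simp]:
  assumes "f \<in> Arr C" "g \<in> Arr C" "Cod C f = Cod C g" "Dom C f = X" "Dom C g = Y"
  shows "\<lbrace>f, g\<rbrace> \<cdot> Inl C X Y = f" "\<lbrace>f, g\<rbrace> \<cdot> Inr C X Y = g"
  using Copairing_Inl[of f X "Cod C f" g Y] Copairing_Inr[of f X "Cod C f" g Y] assms
  by (auto simp: hom_iff)

lemma Copairing_inj_Comp [simp]:
  assumes "f \<in> Arr C" "g \<in> Arr C" "Cod C f = Cod C g" "Dom C f = X" "Dom C g = Y" "h \<in> Arr C"
  shows "Cod C h = X \<Longrightarrow> \<lbrace>f, g\<rbrace> \<cdot> (Inl C X Y \<cdot> h) = f \<cdot> h"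
    "Cod C h = Y \<Longrightarrow> \<lbrace>f, g\<rbrace> \<cdot> (Inr C X Y \<cdot> h) = g \<cdot> h"
  using assms by (simp_all add: Comp_reassoc[OF Copairing_inj(1)] Comp_reassoc[OF Copairing_inj(2)])

lemma Copairing_eqI:
  assumes "h \<in> hom C (X \<oplus> Y) Z" "k \<in> hom C (X \<oplus> Y) Z"
    and "h \<cdot> Inl C X Y = k \<cdot> Inl C X Y" "h \<cdot> Inr C X Y = k \<cdot> Inr C X Y"
  shows "h = k"
  using Copairing_unique[OF assms(1)] Copairing_unique[OF assms(2)] assms(3,4) by metis

lemma Comp_Copairing [simp]:
  assumes "f \<in> Arr C" "g \<in> Arr C" "Cod C f = Cod C g" "h \<in> Arr C" "Dom C h = Cod C g"
  shows "h \<cdot> \<lbrace>f, g\<rbrace> = \<lbrace>h \<cdot> f, h \<cdot> g\<rbrace>"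
proof (rule Copairing_eqI)
  show "h \<cdot> \<lbrace>f, g\<rbrace> \<in> hom C (Dom C f \<oplus> Dom C g) (Cod C h)"
    "\<lbrace>h \<cdot> f, h \<cdot> g\<rbrace> \<in> hom C (Dom C f \<oplus> Dom C g) (Cod C h)"
    using assms by (auto simp: hom_iff)
qed (use assms in simp_all)

text \<open>\<open>Comp_Copairing\<close> spreads a composite over the branches; this rule and the
  two after it fold it back when the branches are one arrow composed with both injections.\<close>

lemma Copairing_Comp_inj [simp]:
  "h \<in> Arr C \<Longrightarrow> Dom C h = X \<oplus> Y \<Longrightarrow> \<lbrace>h \<cdot> Inl C X Y, h \<cdot> Inr C X Y\<rbrace> = h"
  using Copairing_unique[of h X Y "Cod C h"] by (simp add: hom_iff)

lemma Copairing_Comp_Comp_inj [simp]: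
  assumes "h \<in> Arr C" "k \<in> Arr C" "Dom C k = X \<oplus> Y" "Cod C k = Dom C h"
  shows "\<lbrace>h \<cdot> (k \<cdot> Inl C X Y), h \<cdot> (k \<cdot> Inr C X Y)\<rbrace> = h \<cdot> k"
  using Copairing_unique[of "h \<cdot> k" X Y "Cod C h"] assms by (simp add: hom_iff)

lemma Copairing_Inl_Inr [simp]: "\<lbrace>Inl C X Y, Inr C X Y\<rbrace> = Id C (X \<oplus> Y)"
  using Copairing_unique[of "Id C (X \<oplus> Y)" X Y "X \<oplus> Y"] by (simp add: hom_iff)

lemma prod_arr_typing [simp]:
  assumes "f \<in> Arr C" "g \<in> Arr C"
  shows "f \<otimes>\<^sub>a g \<in> Arr C" "Dom C (f \<otimes>\<^sub>a g) = Dom C f \<otimes> Dom C g"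
    "Cod C (f \<otimes>\<^sub>a g) = Cod C f \<otimes> Cod C g"
  using assms by (simp_all add: prod_arr_def)

lemma prod_arr_Comp [simp]:
  assumes "f \<in> Arr C" "g \<in> Arr C" "h \<in> Arr C" "k \<in> Arr C" "Cod C h = Dom C f" "Cod C k = Dom C g"
  shows "(f \<otimes>\<^sub>a g) \<cdot> (h \<otimes>\<^sub>a k) = (f \<cdot> h) \<otimes>\<^sub>a (g \<cdot> k)"
  using assms by (simp add: prod_arr_def)

lemma codist_hom: "codist C X Y Z \<in> hom C ((X \<otimes> Y) \<oplus> (X \<otimes> Z)) (X \<otimes> (Y \<oplus> Z))"
  by (simp add: codist_def hom_iff)

lemma dist_inverse: "is_inverse C (codist C X Y Z) (dist C X Y Z)"
  unfolding dist_def by (rule inv_arr_inverse[OF codist_hom codist_iso])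

lemma dist_typing [simp]:
  "dist C X Y Z \<in> Arr C" "Dom C (dist C X Y Z) = X \<otimes> (Y \<oplus> Z)"
  "Cod C (dist C X Y Z) = (X \<otimes> Y) \<oplus> (X \<otimes> Z)"
  using dist_inverse[of X Y Z] codist_hom[of X Y Z] by (auto simp: is_inverse_def hom_iff)

text \<open>\<open>dist\<close> after \<open>codist\<close> is the identity; evaluating this on both
  injections gives rules free of \<open>codist\<close>.\<close>

lemma dist_inj [simp]:
  "dist C X Y Z \<cdot> (Id C X \<otimes>\<^sub>a Inl C Y Z) = Inl C (X \<otimes> Y) (X \<otimes> Z)"
  "dist C X Y Z \<cdot> (Id C X \<otimes>\<^sub>a Inr C Y Z) = Inr C (X \<otimes> Y) (X \<otimes> Z)"
proof -
  have "dist C X Y Z \<cdot> codist C X Y Z = Id C ((X \<otimes> Y) \<oplus> (X \<otimes> Z))"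
    using dist_inverse[of X Y Z] codist_hom[of X Y Z] by (simp add: is_inverse_def hom_iff)
  then have eq: "\<lbrace>dist C X Y Z \<cdot> (Id C X \<otimes>\<^sub>a Inl C Y Z), dist C X Y Z \<cdot> (Id C X \<otimes>\<^sub>a Inr C Y Z)\<rbrace> =
      Id C ((X \<otimes> Y) \<oplus> (X \<otimes> Z))" (is "\<lbrace>?l, ?r\<rbrace> = _")
    by (simp add: codist_def)
  have "?l = \<lbrace>?l, ?r\<rbrace> \<cdot> Inl C (X \<otimes> Y) (X \<otimes> Z)" "?r = \<lbrace>?l, ?r\<rbrace> \<cdot> Inr C (X \<otimes> Y) (X \<otimes> Z)"
    by simp_all
  then show "?l = Inl C (X \<otimes> Y) (X \<otimes> Z)" "?r = Inr C (X \<otimes> Y) (X \<otimes> Z)"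
    unfolding eq by simp_all
qed

text \<open>Being an isomorphism, \<open>codist\<close> cancels on the right, which permits case
  analysis under a product.\<close>

lemma prod_coprod_eqI:
  assumes "h \<in> hom C (X \<otimes> (Y \<oplus> Z)) W" "k \<in> hom C (X \<otimes> (Y \<oplus> Z)) W"
    and "h \<cdot> (Id C X \<otimes>\<^sub>a Inl C Y Z) = k \<cdot> (Id C X \<otimes>\<^sub>a Inl C Y Z)"
    and "h \<cdot> (Id C X \<otimes>\<^sub>a Inr C Y Z) = k \<cdot> (Id C X \<otimes>\<^sub>a Inr C Y Z)"
  shows "h = k"
proof -
  have split: "g = (g \<cdot> codist C X Y Z) \<cdot> dist C X Y Z" if "g \<in> hom C (X \<otimes> (Y \<oplus> Z)) W" for g
  proof -
    have "(g \<cdot> codist C X Y Z) \<cdot> dist C X Y Z = g \<cdot> (codist C X Y Z \<cdot> dist C X Y Z)"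
      using that codist_hom[of X Y Z] by (intro Comp_assoc') (auto simp: hom_iff)
    also have "\<dots> = g"
      using that dist_inverse[of X Y Z] codist_hom[of X Y Z]
      by (simp add: is_inverse_def hom_iff)
    finally show ?thesis by simp
  qed
  have "h \<cdot> codist C X Y Z = k \<cdot> codist C X Y Z"
    using assms by (simp add: codist_def hom_iff)
  then show ?thesis
    using split[OF assms(1)] split[OF assms(2)] by simp
qed

end

section \<open>Functors and Kleisli triples\<close>

context endofunctor
begin

lemma fmap_typing [simp]:
  "f \<in> Arr C \<Longrightarrow> fmap F f \<in> Arr C"
  "f \<in> Arr C \<Longrightarrow> Dom C (fmap F f) = fob F (Dom C f)"
  "f \<in> Arr C \<Longrightarrow> Cod C (fmap F f) = fob F (Cod C f)"
  using fmap_hom[of f "Dom C f" "Cod C f"] by (auto simp: hom_iff)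

lemma fmap_Id_simp [simp]: "fmap F (Id C X) = Id C (fob F X)"
  by (rule fmap_Id)

lemma fmap_fmap [simp]:
  "f \<in> Arr C \<Longrightarrow> g \<in> Arr C \<Longrightarrow> Cod C f = Dom C g \<Longrightarrow> fmap F g \<cdot> fmap F f = fmap F (g \<cdot> f)"
  using fmap_Comp[of f "Dom C f" "Cod C f" g "Cod C g"] by (auto simp: hom_iff)

end

lemma functor_of_sel [simp]:
  "fob (functor_of C T) = tob T" "fmap (functor_of C T) = tmap C T" "fstr (functor_of C T) = tstr T"
  by (simp_all add: functor_of_def)

context strong_monad
begin

lemma eta_typing [simp]: "eta T X \<in> Arr C" "Dom C (eta T X) = X" "Cod C (eta T X) = tob T X"
  using eta_hom by (auto simp: hom_iff)

lemma klift_typing [simp]: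
  assumes "f \<in> Arr C" "Dom C f = X" "Cod C f = tob T Y"
  shows "klift T X Y f \<in> Arr C" "Dom C (klift T X Y f) = tob T X" "Cod C (klift T X Y f) = tob T Y"
  using klift_hom[of f X Y] assms by (auto simp: hom_iff)

lemma klift_eta_simp [simp]: "klift T X X (eta T X) = Id C (tob T X)"
  by (rule klift_eta)

lemma klift_Comp_eta_simp [simp]:
  "f \<in> Arr C \<Longrightarrow> Dom C f = X \<Longrightarrow> Cod C f = tob T Y \<Longrightarrow> klift T X Y f \<cdot> eta T X = f"
  by (rule klift_Comp_eta) (simp add: hom_iff)

lemma klift_Comp_eta_Comp [simp]:
  "f \<in> Arr C \<Longrightarrow> Dom C f = X \<Longrightarrow> Cod C f = tob T Y \<Longrightarrow> h \<in> Arr C \<Longrightarrow> Cod C h = X \<Longrightarrow>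
    klift T X Y f \<cdot> (eta T X \<cdot> h) = f \<cdot> h"
  by (simp add: Comp_reassoc[OF klift_Comp_eta_simp])

lemma klift_Comp_klift [simp]:
  assumes "f \<in> Arr C" "Dom C f = Y" "Cod C f = tob T Z" "g \<in> Arr C" "Dom C g = X" "Cod C g = tob T Y"
  shows "klift T Y Z f \<cdot> klift T X Y g = klift T X Z (klift T Y Z f \<cdot> g)"
  using klift_klift[of f Y Z g X] assms by (simp add: hom_iff)

lemma klift_Comp_klift_Comp [simp]:
  assumes "f \<in> Arr C" "Dom C f = Y" "Cod C f = tob T Z" "g \<in> Arr C" "Dom C g = X" "Cod C g = tob T Y"
    and "h \<in> Arr C" "Cod C h = tob T X"
  shows "klift T Y Z f \<cdot> (klift T X Y g \<cdot> h) = klift T X Z (klift T Y Z f \<cdot> g) \<cdot> h"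
  using assms by (simp add: Comp_reassoc[OF klift_Comp_klift])

text \<open>Expanding the functor action lets the rules for composed liftings bring both sides of an
  equation to one normal form.\<close>

lemma tmap_eq:
  "f \<in> Arr C \<Longrightarrow> tmap C T f = klift T (Dom C f) (Cod C f) (eta T (Cod C f) \<cdot> f)"
  by (simp add: tmap_def)

lemma tstr_typing [simp]:
  "tstr T X Y \<in> Arr C" "Dom C (tstr T X Y) = X \<otimes> tob T Y" "Cod C (tstr T X Y) = tob T (X \<otimes> Y)"
  using fstr_hom[of X Y] by (auto simp: hom_iff)

end

section \<open>Iteration\<close>

context complete_elgot_monad
begin

lemma dagger_typing [simp]:
  assumes "f \<in> Arr C" "Dom C f = X" "Cod C f = tob T (Y \<oplus> X)"
  shows "dagger T X Y f \<in> Arr C" "Dom C (dagger T X Y f) = X" "Cod C (dagger T X Y f) = tob T Y"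
  using dagger_hom[of f X Y] assms by (auto simp: hom_iff)

text \<open>When calls come both directly from \<open>f\<close> and through \<open>g\<close>, those
  of \<open>f\<close> may be solved first: naturality puts \<open>g\<close> under the inner
  iteration, and codiagonal merges the two nested iterations.\<close>

lemma dagger_klift:
  assumes "f \<in> hom C X (tob T (Z \<oplus> X))" "g \<in> hom C Z (tob T (Y \<oplus> X))"
  shows "dagger T X Y (klift T (Z \<oplus> X) (Y \<oplus> X) \<lbrace>g, eta T (Y \<oplus> X) \<cdot> Inr C Y X\<rbrace> \<cdot> f) =
    dagger T X Y (klift T Z (Y \<oplus> X) g \<cdot> dagger T X Z f)"
proof -
  \<comment> \<open>The outer summand \<open>X\<close> holds the calls of \<open>f\<close>, the
    inner one those of \<open>g\<close>; merging them gives the left-hand side.\<close>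
  let ?g = "klift T (Z \<oplus> X) ((Y \<oplus> X) \<oplus> X)
      \<lbrace>tmap C T (Inl C (Y \<oplus> X) X) \<cdot> g, eta T ((Y \<oplus> X) \<oplus> X) \<cdot> Inr C (Y \<oplus> X) X\<rbrace> \<cdot> f"
  have "tmap C T \<lbrace>Id C (Y \<oplus> X), Inr C Y X\<rbrace> \<cdot> ?g =
      klift T (Z \<oplus> X) (Y \<oplus> X) \<lbrace>g, eta T (Y \<oplus> X) \<cdot> Inr C Y X\<rbrace> \<cdot> f"
    using assms by (simp add: tmap_eq hom_iff)
  moreover have "?g \<in> hom C X (tob T ((Y \<oplus> X) \<oplus> X))"
    using assms by (simp add: tmap_eq hom_iff)
  ultimately show ?thesis
    using codiagonal_law[of ?g X Y] naturality_law[OF assms] by simp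
qed

text \<open>Elimination for a triangular system: \<open>b\<close> calls only \<open>Z\<close>, so it
  can be solved alone and substituted into \<open>a\<close>. Codiagonal splits the iteration into an
  inner one for the calls to \<open>Z\<close> and an outer one for those to \<open>X\<close>;
  uniformity along the left injection then restricts the outer one to \<open>X\<close>.\<close>

lemma dagger_triangular:
  assumes a: "a \<in> hom C X (tob T (Y \<oplus> (X \<oplus> Z)))" and b: "b \<in> hom C Z (tob T (Y \<oplus> Z))"
  shows "dagger T (X \<oplus> Z) Y \<lbrace>a, tmap C T (Id C Y \<oplus>\<^sub>a Inr C X Z) \<cdot> b\<rbrace> \<cdot> Inl C X Z =
    dagger T X Y (klift T (Y \<oplus> (X \<oplus> Z)) (Y \<oplus> X)
      \<lbrace>eta T (Y \<oplus> X) \<cdot> Inl C Y X,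
       \<lbrace>eta T (Y \<oplus> X) \<cdot> Inr C Y X, tmap C T (Inl C Y X) \<cdot> dagger T Z Y b\<rbrace>\<rbrace> \<cdot> a)"
    (is "dagger T ?XZ Y ?h \<cdot> _ = dagger T X Y ?c")
proof -
  define W where "W = Y \<oplus> (X \<oplus> Z)"
  \<comment> \<open>\<open>\<alpha>\<close> and \<open>\<beta>\<close> sort the exits: results in
    \<open>Y\<close> and calls to \<open>X\<close> leave the inner iteration through
    \<open>W\<close>, calls to \<open>Z\<close> stay in it.\<close>
  define \<alpha> where "\<alpha> = \<lbrace>Inl C W ?XZ \<cdot> Inl C Y ?XZ,
    \<lbrace>Inl C W ?XZ \<cdot> (Inr C Y ?XZ \<cdot> Inl C X Z), Inr C W ?XZ \<cdot> Inr C X Z\<rbrace>\<rbrace>"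
  define \<beta> where "\<beta> = \<lbrace>Inl C W ?XZ \<cdot> Inl C Y ?XZ, Inr C W ?XZ \<cdot> Inr C X Z\<rbrace>"
  define p where "p = \<lbrace>tmap C T \<alpha> \<cdot> a, tmap C T \<beta> \<cdot> b\<rbrace>"
  have typing [simp]: "\<alpha> \<in> Arr C" "Dom C \<alpha> = W" "Cod C \<alpha> = W \<oplus> ?XZ"
    "\<beta> \<in> Arr C" "Dom C \<beta> = Y \<oplus> Z" "Cod C \<beta> = W \<oplus> ?XZ"
    "a \<in> Arr C" "Dom C a = X" "Cod C a = tob T W"
    "b \<in> Arr C" "Dom C b = Z" "Cod C b = tob T (Y \<oplus> Z)"
    using a b by (simp_all add: \<alpha>_def \<beta>_def W_def hom_iff)
  have p: "p \<in> hom C ?XZ (tob T (W \<oplus> ?XZ))"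
    and p_inj: "p \<cdot> Inl C X Z = tmap C T \<alpha> \<cdot> a" "p \<cdot> Inr C X Z = tmap C T \<beta> \<cdot> b"
    by (simp_all add: p_def hom_iff tmap_eq)
  have p_typing [simp]: "p \<in> Arr C" "Dom C p = ?XZ" "Cod C p = tob T (W \<oplus> ?XZ)"
    using p by (simp_all add: hom_iff)
  \<comment> \<open>On \<open>Z\<close> the inner iteration is that of \<open>b\<close>, by
    uniformity along the right injection, with naturality relabelling its results.\<close>
  have p_Inr: "dagger T ?XZ W p \<cdot> Inr C X Z = tmap C T (Inl C Y ?XZ) \<cdot> dagger T Z Y b"
  proof -
    let ?b = "klift T (Y \<oplus> Z) (W \<oplus> Z)
      \<lbrace>tmap C T (Inl C W Z) \<cdot> (eta T W \<cdot> Inl C Y ?XZ), eta T (W \<oplus> Z) \<cdot> Inr C W Z\<rbrace> \<cdot> b"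
    have "dagger T ?XZ W p \<cdot> Inr C X Z = dagger T Z W ?b"
    proof (rule uniformity_law[OF p])
      show "p \<cdot> Inr C X Z = tmap C T (Id C W \<oplus>\<^sub>a Inr C X Z) \<cdot> ?b"
        by (simp add: p_inj \<beta>_def tmap_eq coprod_arr_def W_def)
    qed (simp_all add: hom_iff tmap_eq W_def)
    also have "\<dots> = klift T Y W (eta T W \<cdot> Inl C Y ?XZ) \<cdot> dagger T Z Y b"
      by (rule naturality_law[symmetric]) (simp_all add: hom_iff W_def)
    finally show ?thesis by (simp add: tmap_eq W_def)
  qed
  have c: "?c \<in> hom C X (tob T (Y \<oplus> X))"
    using typing by (simp add: hom_iff tmap_eq W_def)
  \<comment> \<open>On \<open>X\<close> one unfolding suffices, since every call that
    \<open>a\<close> makes to \<open>X\<close> is postponed to the outer iteration.\<close>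
  have p_Inl: "dagger T ?XZ W p \<cdot> Inl C X Z = tmap C T (Id C Y \<oplus>\<^sub>a Inl C X Z) \<cdot> ?c"
  proof -
    have "dagger T ?XZ W p \<cdot> Inl C X Z =
        klift T (W \<oplus> ?XZ) W \<lbrace>eta T W, dagger T ?XZ W p\<rbrace> \<cdot> (p \<cdot> Inl C X Z)"
      by (rule Comp_reassoc[OF unfolding_law[OF p], symmetric]) simp_all
    also have "\<dots> = klift T W W \<lbrace>eta T W \<cdot> Inl C Y ?XZ, \<lbrace>eta T W \<cdot> (Inr C Y ?XZ \<cdot> Inl C X Z),
        dagger T ?XZ W p \<cdot> Inr C X Z\<rbrace>\<rbrace> \<cdot> a"
      by (simp add: p_inj tmap_eq \<alpha>_def W_def)
    also have "\<dots> = tmap C T (Id C Y \<oplus>\<^sub>a Inl C X Z) \<cdot> ?c"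
      unfolding p_Inr using typing by (simp add: tmap_eq W_def coprod_arr_def)
    finally show ?thesis .
  qed
  have "?h = tmap C T \<lbrace>Id C W, Inr C Y ?XZ\<rbrace> \<cdot> p"
    using typing by (simp add: p_def \<alpha>_def \<beta>_def W_def tmap_eq coprod_arr_def)
  then have "dagger T ?XZ Y ?h = dagger T ?XZ Y (dagger T ?XZ W p)"
    using codiagonal_law[of p ?XZ Y] p by (simp add: W_def)
  moreover have "dagger T ?XZ Y (dagger T ?XZ W p) \<cdot> Inl C X Z = dagger T X Y ?c"
    by (rule uniformity_law[OF _ c _ p_Inl]) (simp_all add: hom_iff W_def)
  ultimately show ?thesis by simp
qed

end

section \<open>The resumption monad\<close>

text \<open>The final coalgebras come without the monad structure on \<open>V\<close>, so that the
  descriptions defining that structure can first be shown to be well defined.\<close>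

locale resumption_coalgebra =
  T: complete_elgot_monad C T + \<Sigma>: strong_functor C \<Sigma>
  for C :: "('o, 'm) bicart" (structure) and T :: "('o, 'm) elgot" and \<Sigma> :: "('o, 'm) sfunc" +
  fixes V :: "'o \<Rightarrow> 'o" and out :: "'o \<Rightarrow> 'm"
  assumes out_final: "final_coalgebra C (resump_functor C T \<Sigma> X) (V X) (out X)"
begin

section \<open>Coiteration and invertibility of \<open>out\<close>\<close>

lemma out_typing [simp]:
  "out X \<in> Arr C" "Dom C (out X) = V X" "Cod C (out X) = tob T (X \<oplus> fob \<Sigma> (V X))"
  using out_final[of X] by (auto simp: final_coalgebra_def hom_iff resump_functor_def)

lemma coalgebra_ex1:
  assumes "c \<in> hom C Z (tob T (X \<oplus> fob \<Sigma> Z))"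
  shows "\<exists>!h. h \<in> hom C Z (V X) \<and> out X \<cdot> h = tmap C T (Id C X \<oplus>\<^sub>a fmap \<Sigma> h) \<cdot> c"
  using out_final[of X] assms by (auto simp: final_coalgebra_def resump_functor_def)

lemma coalgebra_endo_Id:
  assumes "r \<in> hom C (V X) (V X)" "out X \<cdot> r = tmap C T (Id C X \<oplus>\<^sub>a fmap \<Sigma> r) \<cdot> out X"
  shows "r = Id C (V X)"
proof -
  have "out X \<in> hom C (V X) (tob T (X \<oplus> fob \<Sigma> (V X)))"
    by (simp add: hom_iff)
  from coalgebra_ex1[OF this]
  have "h = k" if "h \<in> hom C (V X) (V X)" "out X \<cdot> h = tmap C T (Id C X \<oplus>\<^sub>a fmap \<Sigma> h) \<cdot> out X"
    "k \<in> hom C (V X) (V X)" "out X \<cdot> k = tmap C T (Id C X \<oplus>\<^sub>a fmap \<Sigma> k) \<cdot> out X" for h k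
    using that by blast
  from this[OF assms, of "Id C (V X)"] show ?thesis
    by (simp add: hom_iff coprod_arr_def T.tmap_eq)
qed

text \<open>Lambek's lemma: coiterating \<open>?F (out X)\<close> yields \<open>h\<close> such that
  \<open>h \<cdot> out X\<close> is a coalgebra endomorphism, hence the identity; functoriality then
  makes \<open>out X \<cdot> h\<close> the identity as well.\<close>

lemma out_iso: "is_iso C (out X)"
proof -
  let ?F = "\<lambda>h. tmap C T (Id C X \<oplus>\<^sub>a fmap \<Sigma> h)"
  have "?F (out X) \<in> hom C (tob T (X \<oplus> fob \<Sigma> (V X)))
      (tob T (X \<oplus> fob \<Sigma> (tob T (X \<oplus> fob \<Sigma> (V X)))))"
    by (simp add: hom_iff coprod_arr_def T.tmap_eq)
  then obtain h where h: "h \<in> hom C (tob T (X \<oplus> fob \<Sigma> (V X))) (V X)"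
    "out X \<cdot> h = ?F h \<cdot> ?F (out X)"
    using coalgebra_ex1 by blast
  have F_Comp: "?F g \<cdot> ?F f = ?F (g \<cdot> f)" if "f \<in> Arr C" "g \<in> Arr C" "Cod C f = Dom C g" for f g
    using that by (simp add: coprod_arr_def T.tmap_eq)
  have hF: "?F h \<cdot> ?F (out X) = ?F (h \<cdot> out X)"
    using h(1) by (intro F_Comp) (simp_all add: hom_iff)
  have "h \<cdot> out X = Id C (V X)"
  proof (rule coalgebra_endo_Id)
    show "out X \<cdot> (h \<cdot> out X) = ?F (h \<cdot> out X) \<cdot> out X"
      using T.Comp_reassoc[OF h(2), of "out X"] h(1) by (simp add: hom_iff hF)
  qed (use h(1) in \<open>simp add: hom_iff\<close>)
  moreover from this have "out X \<cdot> h = Id C (tob T (X \<oplus> fob \<Sigma> (V X)))"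
    using h(2) hF by (simp add: coprod_arr_def T.tmap_eq)
  ultimately show ?thesis
    unfolding is_iso_def is_inverse_def using h(1) by (auto simp: hom_iff)
qed

lemma inv_out: "is_inverse C (out X) (inv_arr C (out X))"
  by (rule T.inv_arr_inverse[OF _ out_iso]) (simp add: hom_iff)

lemma inv_out_typing [simp]:
  "inv_arr C (out X) \<in> Arr C" "Dom C (inv_arr C (out X)) = tob T (X \<oplus> fob \<Sigma> (V X))"
  "Cod C (inv_arr C (out X)) = V X"
  using inv_out[of X] by (auto simp: is_inverse_def hom_iff)

lemma out_inv_out [simp]: "out X \<cdot> inv_arr C (out X) = Id C (tob T (X \<oplus> fob \<Sigma> (V X)))"
  using inv_out[of X] by (simp add: is_inverse_def)

lemma out_inv_out_Comp [simp]:
  "h \<in> Arr C \<Longrightarrow> Cod C h = tob T (X \<oplus> fob \<Sigma> (V X)) \<Longrightarrow> out X \<cdot> (inv_arr C (out X) \<cdot> h) = h"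
  by (subst T.Comp_reassoc[OF out_inv_out]) simp_all

lemma out_cancel:
  assumes "f \<in> hom C Z (V X)" "g \<in> hom C Z (V X)" "out X \<cdot> f = out X \<cdot> g"
  shows "f = g"
proof -
  have "inv_arr C (out X) \<cdot> (out X \<cdot> h) = h" if "h \<in> hom C Z (V X)" for h
    using T.Comp_reassoc[of "inv_arr C (out X)" "out X" "Id C (V X)" h] inv_out[of X] that
    by (simp add: is_inverse_def hom_iff)
  from this[OF assms(1)] this[OF assms(2)] assms(3) show ?thesis by metis
qed

section \<open>Unit, Kleisli lifting and strength solve their defining equations\<close>

lemma resump_eta_char:
  "resump_eta C T \<Sigma> V out X \<in> hom C X (V X) \<and>
    out X \<cdot> resump_eta C T \<Sigma> V out X = eta T (X \<oplus> fob \<Sigma> (V X)) \<cdot> Inl C X (fob \<Sigma> (V X))"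
  unfolding resump_eta_def
proof (rule theI', rule ex_ex1I)
  show "\<exists>e. e \<in> hom C X (V X) \<and>
      out X \<cdot> e = eta T (X \<oplus> fob \<Sigma> (V X)) \<cdot> Inl C X (fob \<Sigma> (V X))"
    by (rule exI[of _ "inv_arr C (out X) \<cdot> (eta T (X \<oplus> fob \<Sigma> (V X)) \<cdot> Inl C X (fob \<Sigma> (V X)))"])
      (simp add: hom_iff)
qed (use out_cancel in metis)

text \<open>The equation is not one for coalgebra morphisms, because the branch
  \<open>out Y \<cdot> f\<close> continues in \<open>V Y\<close> instead of \<open>V X\<close>.
  Adding \<open>V Y\<close> to the state space makes it plain coiteration.\<close>

lemma resump_klift_char:
  assumes "f \<in> hom C X (V Y)"
  shows "resump_klift C T \<Sigma> V out X Y f \<in> hom C (V X) (V Y) \<and>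
    out Y \<cdot> resump_klift C T \<Sigma> V out X Y f =
      klift T (X \<oplus> fob \<Sigma> (V X)) (Y \<oplus> fob \<Sigma> (V Y))
       \<lbrace>out Y \<cdot> f, eta T (Y \<oplus> fob \<Sigma> (V Y)) \<cdot> Inr C Y (fob \<Sigma> (V Y)) \<cdot>
         fmap \<Sigma> (resump_klift C T \<Sigma> V out X Y f)\<rbrace> \<cdot> out X"
proof -
  have f [simp]: "f \<in> Arr C" "Dom C f = X" "Cod C f = V Y"
    using assms by (simp_all add: hom_iff)
  let ?I = "tmap C T (Id C Y \<oplus>\<^sub>a fmap \<Sigma> (Inr C (V X) (V Y)))"
  let ?W = "V X \<oplus> V Y"
  \<comment> \<open>The left summand runs the argument until it returns and then \<open>f\<close>;
    the right summand only copies an element of \<open>V Y\<close>.\<close>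
  define c where "c = \<lbrace>klift T (X \<oplus> fob \<Sigma> (V X)) (Y \<oplus> fob \<Sigma> ?W)
      \<lbrace>?I \<cdot> (out Y \<cdot> f), eta T (Y \<oplus> fob \<Sigma> ?W) \<cdot> (Inr C Y (fob \<Sigma> ?W) \<cdot> fmap \<Sigma> (Inl C (V X) (V Y)))\<rbrace> \<cdot>
      out X, ?I \<cdot> out Y\<rbrace>"
  have c: "c \<in> hom C ?W (tob T (Y \<oplus> fob \<Sigma> ?W))"
    by (simp add: c_def hom_iff T.tmap_eq coprod_arr_def)
  let ?P = "\<lambda>h. h \<in> hom C (V X) (V Y) \<and> out Y \<cdot> h =
      klift T (X \<oplus> fob \<Sigma> (V X)) (Y \<oplus> fob \<Sigma> (V Y))
       \<lbrace>out Y \<cdot> f, eta T (Y \<oplus> fob \<Sigma> (V Y)) \<cdot> Inr C Y (fob \<Sigma> (V Y)) \<cdot> fmap \<Sigma> h\<rbrace> \<cdot> out X"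
  have "\<exists>!h. ?P h"
  proof -
    obtain k where k: "k \<in> hom C ?W (V Y)" "out Y \<cdot> k = tmap C T (Id C Y \<oplus>\<^sub>a fmap \<Sigma> k) \<cdot> c"
      and k_unique: "\<And>k'. k' \<in> hom C ?W (V Y) \<Longrightarrow>
        out Y \<cdot> k' = tmap C T (Id C Y \<oplus>\<^sub>a fmap \<Sigma> k') \<cdot> c \<Longrightarrow> k' = k"
      using coalgebra_ex1[OF c] by blast
    have k_typing [simp]: "k \<in> Arr C" "Dom C k = ?W" "Cod C k = V Y"
      using k(1) by (simp_all add: hom_iff)
    have c_typing [simp]: "c \<in> Arr C" "Dom C c = ?W" "Cod C c = tob T (Y \<oplus> fob \<Sigma> ?W)"
      using c by (simp_all add: hom_iff)
    have c_inj: "c \<cdot> Inl C (V X) (V Y) = klift T (X \<oplus> fob \<Sigma> (V X)) (Y \<oplus> fob \<Sigma> ?W)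
        \<lbrace>?I \<cdot> (out Y \<cdot> f), eta T (Y \<oplus> fob \<Sigma> ?W) \<cdot> (Inr C Y (fob \<Sigma> ?W) \<cdot> fmap \<Sigma> (Inl C (V X) (V Y)))\<rbrace> \<cdot>
        out X"
      "c \<cdot> Inr C (V X) (V Y) = ?I \<cdot> out Y"
      by (simp_all add: c_def T.tmap_eq coprod_arr_def)
    have out_k: "out Y \<cdot> (k \<cdot> g) = tmap C T (Id C Y \<oplus>\<^sub>a fmap \<Sigma> k) \<cdot> (c \<cdot> g)"
      if "g \<in> Arr C" "Cod C g = ?W" for g
      by (subst T.Comp_reassoc[OF k(2)]) (use that in \<open>simp_all add: T.tmap_eq coprod_arr_def\<close>)
    \<comment> \<open>The right component of \<open>k\<close> is an endomorphism of the final
      coalgebra.\<close>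
    have k_Inr: "k \<cdot> Inr C (V X) (V Y) = Id C (V Y)"
      by (rule coalgebra_endo_Id) (simp_all add: hom_iff out_k c_inj T.tmap_eq coprod_arr_def)
    have "?P (k \<cdot> Inl C (V X) (V Y))"
      by (simp add: hom_iff out_k c_inj k_Inr T.tmap_eq coprod_arr_def)
    moreover have "h = k \<cdot> Inl C (V X) (V Y)" if h: "?P h" for h
    proof -
      have h_typing [simp]: "h \<in> Arr C" "Dom C h = V X" "Cod C h = V Y"
        using h by (simp_all add: hom_iff)
      \<comment> \<open>Any solution \<open>h\<close>, extended by the identity, is a coalgebra
        morphism from \<open>c\<close>; this gives uniqueness.\<close>
      have "\<lbrace>h, Id C (V Y)\<rbrace> = k"
        by (rule k_unique) (use h in \<open>simp_all add: hom_iff c_def T.tmap_eq coprod_arr_def\<close>)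
      then show ?thesis by auto
    qed
    ultimately show ?thesis by blast
  qed
  from theI'[OF this] show ?thesis by (simp only: resump_klift_def)
qed

text \<open>Unlike Kleisli lifting, the strength is already defined by plain coiteration on
  \<open>X \<otimes> V Y\<close>.\<close>

lemma resump_str_char:
  "resump_str C T \<Sigma> V out X Y \<in> hom C (X \<otimes> V Y) (V (X \<otimes> Y)) \<and>
    out (X \<otimes> Y) \<cdot> resump_str C T \<Sigma> V out X Y =
       tmap C T (Id C (X \<otimes> Y) \<oplus>\<^sub>a fmap \<Sigma> (resump_str C T \<Sigma> V out X Y)) \<cdot>
       tmap C T ((Id C (X \<otimes> Y) \<oplus>\<^sub>a fstr \<Sigma> X (V Y)) \<cdot> dist C X Y (fob \<Sigma> (V Y))) \<cdot>
       tstr T X (Y \<oplus> fob \<Sigma> (V Y)) \<cdot> (Id C X \<otimes>\<^sub>a out Y)"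
  unfolding resump_str_def
proof (rule theI', rule coalgebra_ex1)
  have "fstr \<Sigma> X (V Y) \<in> Arr C" "Dom C (fstr \<Sigma> X (V Y)) = X \<otimes> fob \<Sigma> (V Y)"
    "Cod C (fstr \<Sigma> X (V Y)) = fob \<Sigma> (X \<otimes> V Y)"
    using \<Sigma>.fstr_hom[of X "V Y"] by (auto simp: hom_iff)
  then show "tmap C T ((Id C (X \<otimes> Y) \<oplus>\<^sub>a fstr \<Sigma> X (V Y)) \<cdot> dist C X Y (fob \<Sigma> (V Y))) \<cdot>
       tstr T X (Y \<oplus> fob \<Sigma> (V Y)) \<cdot> (Id C X \<otimes>\<^sub>a out Y) \<in> hom C (X \<otimes> V Y)
       (tob T ((X \<otimes> Y) \<oplus> fob \<Sigma> (X \<otimes> V Y)))"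
    by (simp add: hom_iff T.tmap_eq coprod_arr_def)
qed
end

text \<open>Here \<open>R\<close> is the monad \<open>T\<^sub>\<Sigma>\<close>, given by the equations that characterize its structure.\<close>

locale resumption_monad =
  resumption_coalgebra C T \<Sigma> "tob R" out + R: complete_elgot_monad C R
  for C :: "('o, 'm) bicart" (structure) and T R :: "('o, 'm) elgot" and \<Sigma> :: "('o, 'm) sfunc"
    and out :: "'o \<Rightarrow> 'm" +
  assumes out_eta: "out X \<cdot> eta R X = eta T (X \<oplus> fob \<Sigma> (tob R X)) \<cdot> Inl C X (fob \<Sigma> (tob R X))"
    and out_klift: "f \<in> hom C X (tob R Y) \<Longrightarrow> out Y \<cdot> klift R X Y f =
      klift T (X \<oplus> fob \<Sigma> (tob R X)) (Y \<oplus> fob \<Sigma> (tob R Y))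
       \<lbrace>out Y \<cdot> f, eta T (Y \<oplus> fob \<Sigma> (tob R Y)) \<cdot> Inr C Y (fob \<Sigma> (tob R Y)) \<cdot>
         fmap \<Sigma> (klift R X Y f)\<rbrace> \<cdot> out X"
    and out_tstr: "out (X \<otimes> Y) \<cdot> tstr R X Y =
       tmap C T (Id C (X \<otimes> Y) \<oplus>\<^sub>a fmap \<Sigma> (tstr R X Y)) \<cdot>
       tmap C T ((Id C (X \<otimes> Y) \<oplus>\<^sub>a fstr \<Sigma> X (tob R Y)) \<cdot> dist C X Y (fob \<Sigma> (tob R Y))) \<cdot>
       tstr T X (Y \<oplus> fob \<Sigma> (tob R Y)) \<cdot> (Id C X \<otimes>\<^sub>a out Y)"
    and out_dagger: "f \<in> hom C X (tob R (Y \<oplus> X)) \<Longrightarrow> g \<in> hom C X (tob T (Y \<oplus> X)) \<Longrightarrow>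
      out (Y \<oplus> X) \<cdot> f = tmap C T (Inl C (Y \<oplus> X) (fob \<Sigma> (tob R (Y \<oplus> X)))) \<cdot> g \<Longrightarrow>
      out Y \<cdot> dagger R X Y f = tmap C T (Inl C Y (fob \<Sigma> (tob R Y))) \<cdot> dagger T X Y g"
begin

section \<open>Calculation in \<open>R\<close> through \<open>out\<close>\<close>

declare out_eta [simp]

lemma out_eta_Comp [simp]:
  "h \<in> Arr C \<Longrightarrow> Cod C h = X \<Longrightarrow>
    out X \<cdot> (eta R X \<cdot> h) = eta T (X \<oplus> fob \<Sigma> (tob R X)) \<cdot> (Inl C X (fob \<Sigma> (tob R X)) \<cdot> h)"
  by (subst T.Comp_reassoc[OF out_eta]) simp_all

lemma out_klift_simp [simp]:
  assumes "f \<in> Arr C" "Dom C f = X" "Cod C f = tob R Y"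
  shows "out Y \<cdot> klift R X Y f =
      klift T (X \<oplus> fob \<Sigma> (tob R X)) (Y \<oplus> fob \<Sigma> (tob R Y))
       \<lbrace>out Y \<cdot> f, eta T (Y \<oplus> fob \<Sigma> (tob R Y)) \<cdot> (Inr C Y (fob \<Sigma> (tob R Y)) \<cdot>
         fmap \<Sigma> (klift R X Y f))\<rbrace> \<cdot> out X"
  using out_klift[of f X Y, unfolded hom_iff] assms by simp

lemma out_klift_Comp [simp]:
  assumes "f \<in> Arr C" "Dom C f = X" "Cod C f = tob R Y" "h \<in> Arr C" "Cod C h = tob R X"
  shows "out Y \<cdot> (klift R X Y f \<cdot> h) =
      klift T (X \<oplus> fob \<Sigma> (tob R X)) (Y \<oplus> fob \<Sigma> (tob R Y))
       \<lbrace>out Y \<cdot> f, eta T (Y \<oplus> fob \<Sigma> (tob R Y)) \<cdot> (Inr C Y (fob \<Sigma> (tob R Y)) \<cdot>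
         fmap \<Sigma> (klift R X Y f))\<rbrace> \<cdot> (out X \<cdot> h)"
  by (subst T.Comp_reassoc[OF out_klift_simp]) (use assms in simp_all)

definition ext :: "'o \<Rightarrow> 'm" where
  "ext X = inv_arr C (out X) \<cdot> tmap C T (Inl C X (fob \<Sigma> (tob R X)))"

text \<open>One layer of \<Sigma> viewed as a computation; composing it with
  \<open>fmap \<Sigma> (eta R X)\<close> gives \<iota>.\<close>

definition guard :: "'o \<Rightarrow> 'm" where
  "guard X = inv_arr C (out X) \<cdot> eta T (X \<oplus> fob \<Sigma> (tob R X)) \<cdot> Inr C X (fob \<Sigma> (tob R X))"

lemma ext_typing [simp]: "ext X \<in> Arr C" "Dom C (ext X) = tob T X" "Cod C (ext X) = tob R X"
  by (simp_all add: ext_def T.tmap_eq)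

lemma guard_typing [simp]:
  "guard X \<in> Arr C" "Dom C (guard X) = fob \<Sigma> (tob R X)" "Cod C (guard X) = tob R X"
  by (simp_all add: guard_def)

lemma out_ext [simp]:
  "out X \<cdot> ext X = klift T X (X \<oplus> fob \<Sigma> (tob R X))
    (eta T (X \<oplus> fob \<Sigma> (tob R X)) \<cdot> Inl C X (fob \<Sigma> (tob R X)))"
  by (simp add: ext_def T.tmap_eq)

lemma out_ext_Comp [simp]:
  "h \<in> Arr C \<Longrightarrow> Cod C h = tob T X \<Longrightarrow> out X \<cdot> (ext X \<cdot> h) =
    klift T X (X \<oplus> fob \<Sigma> (tob R X))
      (eta T (X \<oplus> fob \<Sigma> (tob R X)) \<cdot> Inl C X (fob \<Sigma> (tob R X))) \<cdot> h"
  by (simp add: ext_def T.tmap_eq)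

lemma out_guard [simp]:
  "out X \<cdot> guard X = eta T (X \<oplus> fob \<Sigma> (tob R X)) \<cdot> Inr C X (fob \<Sigma> (tob R X))"
  by (simp add: guard_def)

lemma out_guard_Comp [simp]:
  "h \<in> Arr C \<Longrightarrow> Cod C h = fob \<Sigma> (tob R X) \<Longrightarrow> out X \<cdot> (guard X \<cdot> h) =
    eta T (X \<oplus> fob \<Sigma> (tob R X)) \<cdot> (Inr C X (fob \<Sigma> (tob R X)) \<cdot> h)"
  by (simp add: guard_def)

text \<open>This is where \<open>out_dagger\<close> enters: read through the isomorphism
  \<open>out\<close>, it says that \<open>ext\<close> preserves iteration.\<close>

lemma dagger_ext:
  assumes "g \<in> hom C X (tob T (Y \<oplus> X))"
  shows "dagger R X Y (ext (Y \<oplus> X) \<cdot> g) = ext Y \<cdot> dagger T X Y g"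
proof (rule out_cancel[of _ X Y])
  have "out Y \<cdot> dagger R X Y (ext (Y \<oplus> X) \<cdot> g) =
      tmap C T (Inl C Y (fob \<Sigma> (tob R Y))) \<cdot> dagger T X Y g"
    by (rule out_dagger[OF _ assms]) (use assms in \<open>simp_all add: hom_iff T.tmap_eq\<close>)
  then show "out Y \<cdot> dagger R X Y (ext (Y \<oplus> X) \<cdot> g) = out Y \<cdot> (ext Y \<cdot> dagger T X Y g)"
    using assms by (simp add: hom_iff T.tmap_eq)
qed (use assms in \<open>simp_all add: hom_iff\<close>)

text \<open>The formula for \<zeta> with \<open>R\<close> in place of \<open>S\<close>,
  \<open>ext\<close> in place of \<sigma> and \<iota> in place of \<upsilon>.\<close>

definition zeta_self :: "'o \<Rightarrow> 'm" where
  "zeta_self X = klift R (X \<oplus> fob \<Sigma> (tob R X)) (X \<oplus> tob R X)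
     \<lbrace>eta R (X \<oplus> tob R X) \<cdot> Inl C X (tob R X),
      tmap C R (Inr C X (tob R X)) \<cdot> (guard (tob R X) \<cdot> fmap \<Sigma> (eta R (tob R X)))\<rbrace> \<cdot>
     (ext (X \<oplus> fob \<Sigma> (tob R X)) \<cdot> out X)"

lemma zeta_self_hom: "zeta_self X \<in> hom C (tob R X) (tob R (X \<oplus> tob R X))"
  by (simp add: zeta_self_def hom_iff R.tmap_eq)

lemma dagger_zeta_self: "dagger R (tob R X) X (zeta_self X) = Id C (tob R X)"
proof (rule coalgebra_endo_Id)
  let ?r = "dagger R (tob R X) X (zeta_self X)"
  show r: "?r \<in> hom C (tob R X) (tob R X)"
    using R.dagger_hom[OF zeta_self_hom] .
  define r where "r = ?r"
  have r [simp]: "r \<in> Arr C" "Dom C r = tob R X" "Cod C r = tob R X"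
    using r by (simp_all add: r_def hom_iff)
  have "out X \<cdot> r = out X \<cdot> (klift R (X \<oplus> tob R X) X \<lbrace>eta R X, r\<rbrace> \<cdot> zeta_self X)"
    using R.unfolding_law[OF zeta_self_hom, of X] by (simp add: r_def)
  \<comment> \<open>Under \<open>guard\<close>, the lifting acts as
    \<open>fmap \<Sigma> (klift R (tob R X) X r)\<close>; the unit inside the layer reduces this to
    \<open>fmap \<Sigma> r\<close>.\<close>
  also have "\<dots> = tmap C T (Id C X \<oplus>\<^sub>a fmap \<Sigma> r) \<cdot> out X"
    by (simp add: zeta_self_def R.tmap_eq T.tmap_eq coprod_arr_def)
  finally show "out X \<cdot> ?r = tmap C T (Id C X \<oplus>\<^sub>a fmap \<Sigma> ?r) \<cdot> out X"
    by (simp add: r_def)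
qed

end

section \<open>The extension\<close>

locale resumption_extension = resumption_monad C T R \<Sigma> out + S: complete_elgot_monad C S
  for C :: "('o, 'm) bicart" (structure) and T R S :: "('o, 'm) elgot"
    and \<Sigma> :: "('o, 'm) sfunc" and out :: "'o \<Rightarrow> 'm" +
  fixes \<upsilon> \<sigma> :: "'o \<Rightarrow> 'm"
  assumes \<upsilon>: "strong_nat_trans C \<Sigma> (functor_of C S) \<upsilon>"
    and \<sigma>: "elgot_morphism C T S \<sigma>"
begin

section \<open>Rewriting with \<upsilon> and \<sigma>\<close>

lemma \<upsilon>_typing [simp]:
  "\<upsilon> X \<in> Arr C" "Dom C (\<upsilon> X) = fob \<Sigma> X" "Cod C (\<upsilon> X) = tob S X"
  using \<upsilon> by (simp_all add: strong_nat_trans_def hom_iff)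

lemma \<sigma>_typing [simp]:
  "\<sigma> X \<in> Arr C" "Dom C (\<sigma> X) = tob T X" "Cod C (\<sigma> X) = tob S X"
  using \<sigma> by (simp_all add: elgot_morphism_def strong_nat_trans_def hom_iff)

lemma \<upsilon>_fmap [simp]:
  assumes "f \<in> Arr C" "Cod C f = Y"
  shows "\<upsilon> Y \<cdot> fmap \<Sigma> f = klift S (Dom C f) Y (eta S Y \<cdot> f) \<cdot> \<upsilon> (Dom C f)"
  using \<upsilon> assms by (auto simp: strong_nat_trans_def hom_iff S.tmap_eq)

lemma \<upsilon>_fmap_Comp [simp]:
  assumes "f \<in> Arr C" "Cod C f = Y" "h \<in> Arr C" "Cod C h = fob \<Sigma> (Dom C f)"
  shows "\<upsilon> Y \<cdot> (fmap \<Sigma> f \<cdot> h) = klift S (Dom C f) Y (eta S Y \<cdot> f) \<cdot> (\<upsilon> (Dom C f) \<cdot> h)"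
  by (subst T.Comp_reassoc[OF \<upsilon>_fmap]) (use assms in simp_all)

lemma \<upsilon>_str: "\<upsilon> (X \<otimes> Y) \<cdot> fstr \<Sigma> X Y = tstr S X Y \<cdot> (Id C X \<otimes>\<^sub>a \<upsilon> Y)"
  using \<upsilon> by (simp add: strong_nat_trans_def)

lemma \<sigma>_eta [simp]: "\<sigma> X \<cdot> eta T X = eta S X"
  using \<sigma> by (simp add: elgot_morphism_def)

lemma \<sigma>_eta_Comp [simp]: "h \<in> Arr C \<Longrightarrow> Cod C h = X \<Longrightarrow> \<sigma> X \<cdot> (eta T X \<cdot> h) = eta S X \<cdot> h"
  by (subst T.Comp_reassoc[OF \<sigma>_eta]) simp_all

lemma \<sigma>_klift [simp]:
  assumes "f \<in> Arr C" "Dom C f = X" "Cod C f = tob T Y"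
  shows "\<sigma> Y \<cdot> klift T X Y f = klift S X Y (\<sigma> Y \<cdot> f) \<cdot> \<sigma> X"
  using \<sigma> assms by (auto simp: elgot_morphism_def hom_iff)

lemma \<sigma>_klift_Comp [simp]:
  assumes "f \<in> Arr C" "Dom C f = X" "Cod C f = tob T Y" "h \<in> Arr C" "Cod C h = tob T X"
  shows "\<sigma> Y \<cdot> (klift T X Y f \<cdot> h) = klift S X Y (\<sigma> Y \<cdot> f) \<cdot> (\<sigma> X \<cdot> h)"
  by (subst T.Comp_reassoc[OF \<sigma>_klift]) (use assms in simp_all)

lemma \<sigma>_str: "\<sigma> (X \<otimes> Y) \<cdot> tstr T X Y = tstr S X Y \<cdot> (Id C X \<otimes>\<^sub>a \<sigma> Y)"
  using \<sigma> by (simp add: elgot_morphism_def strong_nat_trans_def)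

lemma \<sigma>_dagger: "g \<in> hom C X (tob T (Y \<oplus> X)) \<Longrightarrow> dagger S X Y (\<sigma> (Y \<oplus> X) \<cdot> g) = \<sigma> Y \<cdot> dagger T X Y g"
  using \<sigma> by (simp add: elgot_morphism_def)

section \<open>The candidate \<open>xi\<close> and its uniqueness\<close>

definition zeta :: "'o \<Rightarrow> 'm" where
  "zeta X = klift S (X \<oplus> fob \<Sigma> (tob R X)) (X \<oplus> tob R X)
     \<lbrace>eta S (X \<oplus> tob R X) \<cdot> Inl C X (tob R X), tmap C S (Inr C X (tob R X)) \<cdot> \<upsilon> (tob R X)\<rbrace> \<cdot>
     (\<sigma> (X \<oplus> fob \<Sigma> (tob R X)) \<cdot> out X)"

lemma zeta_typing [simp]:
  "zeta X \<in> Arr C" "Dom C (zeta X) = tob R X" "Cod C (zeta X) = tob S (X \<oplus> tob R X)"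
  by (simp_all add: zeta_def S.tmap_eq)

definition xi :: "'o \<Rightarrow> 'm" where
  "xi X = dagger S (tob R X) X (zeta X)"

lemma xi_typing [simp]: "xi X \<in> Arr C" "Dom C (xi X) = tob R X" "Cod C (xi X) = tob S X"
  by (simp_all add: xi_def)

lemma morphism_eq_xi:
  assumes \<xi>: "elgot_morphism C R S \<xi>"
    and ext: "\<And>X. \<xi> X \<cdot> ext X = \<sigma> X"
    and iota: "\<And>X. \<xi> X \<cdot> (guard X \<cdot> fmap \<Sigma> (eta R X)) = \<upsilon> X"
  shows "\<xi> X = xi X"
proof -
  have [simp]: "\<xi> Y \<in> Arr C" "Dom C (\<xi> Y) = tob R Y" "Cod C (\<xi> Y) = tob S Y" for Y
    using \<xi> by (auto simp: elgot_morphism_def strong_nat_trans_def hom_iff)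
  have eta: "\<xi> Y \<cdot> (eta R Y \<cdot> h) = eta S Y \<cdot> h" if "h \<in> Arr C" "Cod C h = Y" for Y h
    using \<xi> that by (subst T.Comp_reassoc[where c = "eta S Y"]) (simp_all add: elgot_morphism_def)
  have klift: "\<xi> Y \<cdot> (klift R Z Y f \<cdot> h) = klift S Z Y (\<xi> Y \<cdot> f) \<cdot> (\<xi> Z \<cdot> h)"
    if "f \<in> Arr C" "Dom C f = Z" "Cod C f = tob R Y" "h \<in> Arr C" "Cod C h = tob R Z" for Y Z f h
    using \<xi> that by (subst T.Comp_reassoc[where c = "klift S Z Y (\<xi> Y \<cdot> f) \<cdot> \<xi> Z"])
      (auto simp: elgot_morphism_def hom_iff)
  have ext': "\<xi> Y \<cdot> (ext Y \<cdot> h) = \<sigma> Y \<cdot> h" if "h \<in> Arr C" "Cod C h = tob T Y" for Y h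
    using that by (subst T.Comp_reassoc[OF ext]) simp_all
  \<comment> \<open>Writing the identity as an iteration makes the preservation of iteration
    applicable to \<xi> alone.\<close>
  have "\<xi> X = \<xi> X \<cdot> dagger R (tob R X) X (zeta_self X)"
    by (simp add: dagger_zeta_self)
  also have "\<dots> = dagger S (tob R X) X (\<xi> (X \<oplus> tob R X) \<cdot> zeta_self X)"
    using \<xi> zeta_self_hom by (simp add: elgot_morphism_def)
  also have "\<xi> (X \<oplus> tob R X) \<cdot> zeta_self X = zeta X"
    by (simp add: zeta_self_def zeta_def R.tmap_eq S.tmap_eq eta klift ext' iota)
  finally show ?thesis by (simp add: xi_def)
qed

section \<open>Values of \<open>xi\<close>; preservation of Kleisli lifting and strength\<close>

lemma xi_unfold:
  "xi X = klift S (X \<oplus> fob \<Sigma> (tob R X)) X \<lbrace>eta S X, klift S (tob R X) X (xi X) \<cdot> \<upsilon> (tob R X)\<rbrace> \<cdot>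
     (\<sigma> (X \<oplus> fob \<Sigma> (tob R X)) \<cdot> out X)" (is "_ = ?rhs")
proof -
  have "xi X = klift S (X \<oplus> tob R X) X \<lbrace>eta S X, xi X\<rbrace> \<cdot> zeta X"
    using S.unfolding_law[of "zeta X" "tob R X" X] by (simp add: xi_def hom_iff)
  also have "\<dots> = ?rhs"
    by (simp add: zeta_def S.tmap_eq)
  finally show ?thesis .
qed

text \<open>The unfolding contains \<open>xi X\<close> again and would loop as a rewrite rule. It is
  applied once, to an \<open>f\<close> for which \<open>out X \<cdot> f\<close> is known, and so
  yields the values on the unit, \<open>ext\<close> and \<open>guard\<close>.\<close>

lemma xi_Comp:
  assumes "f \<in> Arr C" "Cod C f = tob R X"
  shows "xi X \<cdot> f = klift S (X \<oplus> fob \<Sigma> (tob R X)) X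
     \<lbrace>eta S X, klift S (tob R X) X (xi X) \<cdot> \<upsilon> (tob R X)\<rbrace> \<cdot>
     (\<sigma> (X \<oplus> fob \<Sigma> (tob R X)) \<cdot> (out X \<cdot> f))"
proof -
  have "xi X \<cdot> f = (klift S (X \<oplus> fob \<Sigma> (tob R X)) X
     \<lbrace>eta S X, klift S (tob R X) X (xi X) \<cdot> \<upsilon> (tob R X)\<rbrace> \<cdot>
     (\<sigma> (X \<oplus> fob \<Sigma> (tob R X)) \<cdot> out X)) \<cdot> f"
    by (rule arg_cong[where f = "\<lambda>h. h \<cdot> f"], rule xi_unfold)
  then show ?thesis using assms by simp
qed

lemma xi_eta [simp]: "xi X \<cdot> eta R X = eta S X"
  by (subst xi_Comp) simp_all

lemma xi_eta_Comp [simp]: "h \<in> Arr C \<Longrightarrow> Cod C h = X \<Longrightarrow> xi X \<cdot> (eta R X \<cdot> h) = eta S X \<cdot> h"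
  by (subst T.Comp_reassoc[OF xi_eta]) simp_all

lemma xi_ext [simp]: "xi X \<cdot> ext X = \<sigma> X"
  by (subst xi_Comp) simp_all

lemma xi_ext_Comp [simp]: "h \<in> Arr C \<Longrightarrow> Cod C h = tob T X \<Longrightarrow> xi X \<cdot> (ext X \<cdot> h) = \<sigma> X \<cdot> h"
  by (subst T.Comp_reassoc[OF xi_ext]) simp_all

lemma xi_guard [simp]: "xi X \<cdot> guard X = klift S (tob R X) X (xi X) \<cdot> \<upsilon> (tob R X)"
  by (subst xi_Comp) simp_all

lemma xi_guard_Comp [simp]:
  "h \<in> Arr C \<Longrightarrow> Cod C h = fob \<Sigma> (tob R X) \<Longrightarrow>
    xi X \<cdot> (guard X \<cdot> h) = klift S (tob R X) X (xi X) \<cdot> (\<upsilon> (tob R X) \<cdot> h)"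
  by (subst T.Comp_reassoc[OF xi_guard]) simp_all

lemma xi_iota: "xi X \<cdot> (guard X \<cdot> fmap \<Sigma> (eta R X)) = \<upsilon> X"
  by simp

text \<open>Evaluating a lifted argument runs in two phases: first the argument, then
  \<open>f\<close>. The states of the phases form the two summands of a triangular system; its
  second phase is solved by \<open>xi Y\<close>, and naturality moves \<open>f\<close> out of the
  first.\<close>

lemma xi_klift:
  assumes "f \<in> hom C X (tob R Y)"
  shows "xi Y \<cdot> klift R X Y f = klift S X Y (xi Y \<cdot> f) \<cdot> xi X"
proof -
  have f [simp]: "f \<in> Arr C" "Dom C f = X" "Cod C f = tob R Y"
    using assms by (simp_all add: hom_iff)
  let ?VX = "tob R X" and ?VY = "tob R Y" and ?k = "klift R X Y f"
  \<comment> \<open>The first evaluation step of \<open>f\<close>, taken when the argument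
    returns.\<close>
  define z where "z = zeta Y \<cdot> f"
  have [simp]: "z \<in> Arr C" "Dom C z = X" "Cod C z = tob S (Y \<oplus> ?VY)"
    by (simp_all add: z_def)
  \<comment> \<open>Solving the calls that \<open>z\<close> leaves open completes the evaluation of
    \<open>f\<close>, by unfolding.\<close>
  have zeta_f: "klift S (Y \<oplus> ?VY) (Y \<oplus> ?VX)
      \<lbrace>eta S (Y \<oplus> ?VX) \<cdot> Inl C Y ?VX, tmap C S (Inl C Y ?VX) \<cdot> xi Y\<rbrace> \<cdot> z =
    tmap C S (Inl C Y ?VX) \<cdot> (xi Y \<cdot> f)"
  proof -
    have "xi Y \<cdot> f = klift S (Y \<oplus> ?VY) Y \<lbrace>eta S Y, xi Y\<rbrace> \<cdot> z"
      unfolding z_def using S.unfolding_law[of "zeta Y" ?VY Y]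
      by (intro T.Comp_reassoc[symmetric]) (simp_all add: xi_def hom_iff)
    then show ?thesis by (simp add: S.tmap_eq)
  qed
  \<comment> \<open>A returned value switches to the second phase through \<open>z\<close>; a layer
    of \<Sigma> stays in the first.\<close>
  define a where "a = klift S (X \<oplus> fob \<Sigma> ?VX) (Y \<oplus> (?VX \<oplus> ?VY))
    \<lbrace>tmap C S (Id C Y \<oplus>\<^sub>a Inr C ?VX ?VY) \<cdot> z,
     tmap C S (Inr C Y (?VX \<oplus> ?VY) \<cdot> Inl C ?VX ?VY) \<cdot> \<upsilon> ?VX\<rbrace> \<cdot> (\<sigma> (X \<oplus> fob \<Sigma> ?VX) \<cdot> out X)"
  have a: "a \<in> hom C ?VX (tob S (Y \<oplus> (?VX \<oplus> ?VY)))"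
    by (simp add: a_def hom_iff S.tmap_eq coprod_arr_def)
  then have [simp]: "a \<in> Arr C" "Dom C a = ?VX" "Cod C a = tob S (Y \<oplus> (?VX \<oplus> ?VY))"
    by (simp_all add: hom_iff)
  let ?h = "\<lbrace>a, tmap C S (Id C Y \<oplus>\<^sub>a Inr C ?VX ?VY) \<cdot> zeta Y\<rbrace>"
  have zeta_k: "zeta Y \<cdot> ?k = tmap C S (Id C Y \<oplus>\<^sub>a \<lbrace>?k, Id C ?VY\<rbrace>) \<cdot> a"
    by (simp add: a_def z_def zeta_def S.tmap_eq coprod_arr_def)
  have h: "xi Y \<cdot> \<lbrace>?k, Id C ?VY\<rbrace> = dagger S (?VX \<oplus> ?VY) Y ?h"
    unfolding xi_def
  proof (rule S.uniformity_law)
    show "zeta Y \<cdot> \<lbrace>?k, Id C ?VY\<rbrace> = tmap C S (Id C Y \<oplus>\<^sub>a \<lbrace>?k, Id C ?VY\<rbrace>) \<cdot> ?h"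
      using zeta_k by (simp add: S.tmap_eq coprod_arr_def)
  qed (simp_all add: hom_iff S.tmap_eq coprod_arr_def)
  have "xi Y \<cdot> ?k = (xi Y \<cdot> \<lbrace>?k, Id C ?VY\<rbrace>) \<cdot> Inl C ?VX ?VY"
    by simp
  also have "\<dots> = dagger S (?VX \<oplus> ?VY) Y ?h \<cdot> Inl C ?VX ?VY"
    unfolding h ..
  also have "\<dots> = dagger S ?VX Y (klift S (Y \<oplus> (?VX \<oplus> ?VY)) (Y \<oplus> ?VX)
      \<lbrace>eta S (Y \<oplus> ?VX) \<cdot> Inl C Y ?VX,
       \<lbrace>eta S (Y \<oplus> ?VX) \<cdot> Inr C Y ?VX, tmap C S (Inl C Y ?VX) \<cdot> xi Y\<rbrace>\<rbrace> \<cdot> a)"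
    unfolding xi_def by (rule S.dagger_triangular[OF a]) (simp add: hom_iff)
  \<comment> \<open>After elimination only \<open>zeta X\<close> remains, with its results passed to
    \<open>xi Y \<cdot> f\<close>: the form required by naturality.\<close>
  also have "klift S (Y \<oplus> (?VX \<oplus> ?VY)) (Y \<oplus> ?VX)
      \<lbrace>eta S (Y \<oplus> ?VX) \<cdot> Inl C Y ?VX,
       \<lbrace>eta S (Y \<oplus> ?VX) \<cdot> Inr C Y ?VX, tmap C S (Inl C Y ?VX) \<cdot> xi Y\<rbrace>\<rbrace> \<cdot> a =
     klift S (X \<oplus> ?VX) (Y \<oplus> ?VX)
      \<lbrace>tmap C S (Inl C Y ?VX) \<cdot> (xi Y \<cdot> f), eta S (Y \<oplus> ?VX) \<cdot> Inr C Y ?VX\<rbrace> \<cdot> zeta X"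
    using zeta_f by (simp add: a_def z_def[symmetric] zeta_def S.tmap_eq coprod_arr_def)
  also have "dagger S ?VX Y \<dots> = klift S X Y (xi Y \<cdot> f) \<cdot> xi X"
    unfolding xi_def[of X] by (rule S.naturality_law[symmetric]) (simp_all add: hom_iff)
  finally show ?thesis .
qed

text \<open>The strength law writes the right-hand side as the iteration of \<open>?g\<close>, and
  uniformity along \<open>tstr R W X\<close> identifies this with the left-hand side.\<close>

lemma xi_str: "xi (W \<otimes> X) \<cdot> tstr R W X = tstr S W X \<cdot> (Id C W \<otimes>\<^sub>a xi X)"
proof -
  let ?V = "tob R X" and ?V' = "tob R (W \<otimes> X)"
  let ?F = "fob \<Sigma> ?V"
  let ?g = "tmap C S (dist C W X ?V) \<cdot> tstr S W (X \<oplus> ?V) \<cdot> (Id C W \<otimes>\<^sub>a zeta X)"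
  have [simp]: "fstr \<Sigma> A B \<in> Arr C" "Dom C (fstr \<Sigma> A B) = A \<otimes> fob \<Sigma> B"
    "Cod C (fstr \<Sigma> A B) = fob \<Sigma> (A \<otimes> B)" for A B
    using \<Sigma>.fstr_hom[of A B] by (auto simp: hom_iff)
  have \<sigma>_str': "\<sigma> (W \<otimes> (X \<oplus> ?F)) \<cdot> (tstr T W (X \<oplus> ?F) \<cdot> h) =
      tstr S W (X \<oplus> ?F) \<cdot> ((Id C W \<otimes>\<^sub>a \<sigma> (X \<oplus> ?F)) \<cdot> h)"
    if "h \<in> Arr C" "Cod C h = W \<otimes> tob T (X \<oplus> ?F)" for h
    using that by (subst T.Comp_reassoc[OF \<sigma>_str]) simp_all
  \<comment> \<open>The continuation in \<open>zeta X\<close>, kept as one arrow so that the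
    strength law for liftings applies to it.\<close>
  define j where "j = \<lbrace>eta S (X \<oplus> ?V) \<cdot> Inl C X ?V, tmap C S (Inr C X ?V) \<cdot> \<upsilon> ?V\<rbrace>"
  have j_typing [simp]: "j \<in> Arr C" "Dom C j = X \<oplus> ?F" "Cod C j = tob S (X \<oplus> ?V)"
    by (simp_all add: j_def S.tmap_eq)
  have tmap_Inr: "tmap C S (Inr C X ?V) = klift S ?V (X \<oplus> ?V) (eta S (X \<oplus> ?V) \<cdot> Inr C X ?V)"
    by (simp add: S.tmap_eq)
  have j_Inl: "j \<cdot> Inl C X ?F = eta S (X \<oplus> ?V) \<cdot> Inl C X ?V"
    and j_Inr: "j \<cdot> Inr C X ?F = tmap C S (Inr C X ?V) \<cdot> \<upsilon> ?V"
    by (simp_all add: j_def tmap_Inr)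
  have zeta_j: "zeta X = klift S (X \<oplus> ?F) (X \<oplus> ?V) j \<cdot> (\<sigma> (X \<oplus> ?F) \<cdot> out X)"
    by (simp add: zeta_def j_def)
  have str_klift: "tstr S W (X \<oplus> ?V) \<cdot> (Id C W \<otimes>\<^sub>a zeta X) =
      klift S (W \<otimes> (X \<oplus> ?F)) (W \<otimes> (X \<oplus> ?V)) (tstr S W (X \<oplus> ?V) \<cdot> (Id C W \<otimes>\<^sub>a j)) \<cdot>
      (tstr S W (X \<oplus> ?F) \<cdot> (Id C W \<otimes>\<^sub>a (\<sigma> (X \<oplus> ?F) \<cdot> out X)))"
  proof -
    have "tstr S W (X \<oplus> ?V) \<cdot> (Id C W \<otimes>\<^sub>a zeta X) = tstr S W (X \<oplus> ?V) \<cdot>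
        ((Id C W \<otimes>\<^sub>a klift S (X \<oplus> ?F) (X \<oplus> ?V) j) \<cdot> (Id C W \<otimes>\<^sub>a (\<sigma> (X \<oplus> ?F) \<cdot> out X)))"
      by (simp add: zeta_j)
    also have "\<dots> = (klift S (W \<otimes> (X \<oplus> ?F)) (W \<otimes> (X \<oplus> ?V)) (tstr S W (X \<oplus> ?V) \<cdot> (Id C W \<otimes>\<^sub>a j)) \<cdot>
        tstr S W (X \<oplus> ?F)) \<cdot> (Id C W \<otimes>\<^sub>a (\<sigma> (X \<oplus> ?F) \<cdot> out X))"
      by (rule T.Comp_reassoc[OF S.tstr_klift]) (simp_all add: hom_iff)
    finally show ?thesis by simp
  qed
  have str_Inr: "tstr S W (X \<oplus> ?V) \<cdot> (Id C W \<otimes>\<^sub>a (tmap C S (Inr C X ?V) \<cdot> \<upsilon> ?V)) =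
      tmap C S (Id C W \<otimes>\<^sub>a Inr C X ?V) \<cdot> (tstr S W ?V \<cdot> (Id C W \<otimes>\<^sub>a \<upsilon> ?V))"
  proof -
    have "tstr S W (X \<oplus> ?V) \<cdot> ((Id C W \<otimes>\<^sub>a tmap C S (Inr C X ?V)) \<cdot> (Id C W \<otimes>\<^sub>a \<upsilon> ?V)) =
        (tmap C S (Id C W \<otimes>\<^sub>a Inr C X ?V) \<cdot> tstr S W ?V) \<cdot> (Id C W \<otimes>\<^sub>a \<upsilon> ?V)"
      using S.fstr_natural[of "Id C W" W W "Inr C X ?V" ?V "X \<oplus> ?V"]
      by (intro T.Comp_reassoc) (simp_all add: hom_iff S.tmap_eq)
    then show ?thesis by (simp add: S.tmap_eq)
  qed
  have str_Inl: "tstr S W (X \<oplus> ?V) \<cdot> (Id C W \<otimes>\<^sub>a (eta S (X \<oplus> ?V) \<cdot> Inl C X ?V)) =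
      eta S (W \<otimes> (X \<oplus> ?V)) \<cdot> (Id C W \<otimes>\<^sub>a Inl C X ?V)"
    using T.Comp_reassoc[OF S.tstr_eta[of W "X \<oplus> ?V"], of "Id C W \<otimes>\<^sub>a Inl C X ?V"] by simp
  \<comment> \<open>Case analysis on the sum under the product: a result keeps its unit, a layer of
    \<Sigma> meets the naturality of the strength.\<close>
  have dist_j: "tmap C S (dist C W X ?V) \<cdot> (tstr S W (X \<oplus> ?V) \<cdot> (Id C W \<otimes>\<^sub>a j)) =
      \<lbrace>eta S ((W \<otimes> X) \<oplus> (W \<otimes> ?V)) \<cdot> Inl C (W \<otimes> X) (W \<otimes> ?V),
       tmap C S (Inr C (W \<otimes> X) (W \<otimes> ?V)) \<cdot> (tstr S W ?V \<cdot> (Id C W \<otimes>\<^sub>a \<upsilon> ?V))\<rbrace> \<cdot> dist C W X ?F"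
    (is "?l = ?r \<cdot> _")
  proof (rule T.prod_coprod_eqI)
    show "?l \<in> hom C (W \<otimes> (X \<oplus> ?F)) (tob S ((W \<otimes> X) \<oplus> (W \<otimes> ?V)))"
      "?r \<cdot> dist C W X ?F \<in> hom C (W \<otimes> (X \<oplus> ?F)) (tob S ((W \<otimes> X) \<oplus> (W \<otimes> ?V)))"
      by (simp_all add: hom_iff S.tmap_eq)
    show "?l \<cdot> (Id C W \<otimes>\<^sub>a Inl C X ?F) = (?r \<cdot> dist C W X ?F) \<cdot> (Id C W \<otimes>\<^sub>a Inl C X ?F)"
      by (simp add: j_Inl str_Inl S.tmap_eq)
    show "?l \<cdot> (Id C W \<otimes>\<^sub>a Inr C X ?F) = (?r \<cdot> dist C W X ?F) \<cdot> (Id C W \<otimes>\<^sub>a Inr C X ?F)"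
      by (simp add: j_Inr str_Inr[unfolded tmap_Inr] S.tmap_eq)
  qed
  have "tstr S W X \<cdot> (Id C W \<otimes>\<^sub>a xi X) = dagger S (W \<otimes> ?V) (W \<otimes> X) ?g"
    unfolding xi_def by (rule S.strength_law) (simp add: hom_iff)
  also have "\<dots> = xi (W \<otimes> X) \<cdot> tstr R W X"
    unfolding xi_def
  proof (rule S.uniformity_law[symmetric])
    \<comment> \<open>\<open>out_tstr\<close> exposes the strengths of \<open>T\<close> and
      \<Sigma>; \<sigma> and \<upsilon> turn them into that of \<open>S\<close>, which matches
      \<open>?g\<close> as computed by \<open>str_klift\<close> and \<open>dist_j\<close>.\<close>
    show "zeta (W \<otimes> X) \<cdot> tstr R W X = tmap C S (Id C (W \<otimes> X) \<oplus>\<^sub>a tstr R W X) \<cdot> ?g"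
      using str_klift dist_j
      by (simp add: zeta_def out_tstr \<upsilon>_str \<sigma>_str' T.Comp_reassoc[OF T.Comp_Copairing]
         S.tmap_eq T.tmap_eq coprod_arr_def)
  qed (simp_all add: hom_iff S.tmap_eq coprod_arr_def)
  finally show ?thesis by simp
qed

section \<open>Preservation of iteration\<close>

lemma xi_klift_simp [simp]:
  "f \<in> Arr C \<Longrightarrow> Dom C f = X \<Longrightarrow> Cod C f = tob R Y \<Longrightarrow>
    xi Y \<cdot> klift R X Y f = klift S X Y (xi Y \<cdot> f) \<cdot> xi X"
  by (rule xi_klift) (simp add: hom_iff)

lemma xi_klift_Comp [simp]:
  assumes "f \<in> Arr C" "Dom C f = X" "Cod C f = tob R Y" "h \<in> Arr C" "Cod C h = tob R X"
  shows "xi Y \<cdot> (klift R X Y f \<cdot> h) = klift S X Y (xi Y \<cdot> f) \<cdot> (xi X \<cdot> h)"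
  by (subst T.Comp_reassoc[OF xi_klift_simp]) (use assms in simp_all)

text \<open>The form of \<open>g\<close> says that it returns in \<open>Y\<close> or produces a
  layer of \<Sigma> containing all further calls. The lifting \<open>s\<close> of the solution is
  then a coalgebra morphism, so that uniformity applies to \<open>xi Y \<cdot> s\<close>.\<close>

lemma xi_dagger_guarded:
  fixes X Y :: 'o
  defines "K \<equiv> fob \<Sigma> (tob R (Y \<oplus> X))"
  assumes e: "e \<in> hom C X (tob T (Y \<oplus> K))"
    and g: "g = klift R (Y \<oplus> K) (Y \<oplus> X) \<lbrace>eta R (Y \<oplus> X) \<cdot> Inl C Y X, guard (Y \<oplus> X)\<rbrace> \<cdot>
      (ext (Y \<oplus> K) \<cdot> e)"
  shows "dagger S X Y (xi (Y \<oplus> X) \<cdot> g) = xi Y \<cdot> dagger R X Y g"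
proof -
  define V where "V = tob R (Y \<oplus> X)"
  have K: "K = fob \<Sigma> V" and V: "tob R (Y \<oplus> X) = V"
    by (simp_all add: K_def V_def)
  have e_typing [simp]: "e \<in> Arr C" "Dom C e = X" "Cod C e = tob T (Y \<oplus> fob \<Sigma> V)"
    using e by (simp_all add: hom_iff K)
  have g_typing [simp]: "g \<in> Arr C" "Dom C g = X" "Cod C g = V"
    by (simp_all add: g K V)
  define d where "d = dagger R X Y g"
  have d_typing [simp]: "d \<in> Arr C" "Dom C d = X" "Cod C d = tob R Y"
    by (simp_all add: d_def V)
  define s where "s = klift R (Y \<oplus> X) Y \<lbrace>eta R Y, d\<rbrace>"
  have s_typing [simp]: "s \<in> Arr C" "Dom C s = V" "Cod C s = tob R Y"
    by (simp_all add: s_def V)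
  have d_eq: "s \<cdot> g = d"
    using R.unfolding_law[of g X Y] by (simp add: s_def d_def hom_iff V)
  have out_g: "out (Y \<oplus> X) \<cdot> g = klift T (Y \<oplus> fob \<Sigma> V) ((Y \<oplus> X) \<oplus> fob \<Sigma> V)
      \<lbrace>eta T ((Y \<oplus> X) \<oplus> fob \<Sigma> V) \<cdot> (Inl C (Y \<oplus> X) (fob \<Sigma> V) \<cdot> Inl C Y X),
       eta T ((Y \<oplus> X) \<oplus> fob \<Sigma> V) \<cdot> Inr C (Y \<oplus> X) (fob \<Sigma> V)\<rbrace> \<cdot> e"
    by (simp add: g K V)
  have out_s_d: "out Y \<cdot> s = klift T ((Y \<oplus> X) \<oplus> fob \<Sigma> V) (Y \<oplus> fob \<Sigma> (tob R Y))
      \<lbrace>\<lbrace>eta T (Y \<oplus> fob \<Sigma> (tob R Y)) \<cdot> Inl C Y (fob \<Sigma> (tob R Y)), out Y \<cdot> d\<rbrace>,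
       eta T (Y \<oplus> fob \<Sigma> (tob R Y)) \<cdot> (Inr C Y (fob \<Sigma> (tob R Y)) \<cdot> fmap \<Sigma> s)\<rbrace> \<cdot> out (Y \<oplus> X)"
    by (simp add: s_def V)
  \<comment> \<open>The solution unfolds to one step of \<open>e\<close> with \<open>s\<close>
    applied inside \<Sigma>: guardedness leaves no call at the outer level.\<close>
  have out_d: "out Y \<cdot> d = tmap C T (Id C Y \<oplus>\<^sub>a fmap \<Sigma> s) \<cdot> e"
  proof -
    have "out Y \<cdot> d = out Y \<cdot> (s \<cdot> g)"
      by (simp add: d_eq)
    also have "\<dots> = tmap C T (Id C Y \<oplus>\<^sub>a fmap \<Sigma> s) \<cdot> e"
      by (subst T.Comp_reassoc[OF out_s_d]) (simp_all add: out_g T.tmap_eq coprod_arr_def V)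
    finally show ?thesis .
  qed
  \<comment> \<open>The coalgebra on \<open>V\<close> from which \<open>s\<close> is a morphism:
    leaves in \<open>X\<close> are expanded by \<open>e\<close>, everything else is kept.\<close>
  define q where "q = klift T ((Y \<oplus> X) \<oplus> fob \<Sigma> V) (Y \<oplus> fob \<Sigma> V)
      \<lbrace>\<lbrace>eta T (Y \<oplus> fob \<Sigma> V) \<cdot> Inl C Y (fob \<Sigma> V), e\<rbrace>,
       eta T (Y \<oplus> fob \<Sigma> V) \<cdot> Inr C Y (fob \<Sigma> V)\<rbrace> \<cdot> out (Y \<oplus> X)"
  have out_s: "out Y \<cdot> s = tmap C T (Id C Y \<oplus>\<^sub>a fmap \<Sigma> s) \<cdot> q"
    by (simp add: out_s_d out_d q_def T.tmap_eq coprod_arr_def V)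
  \<comment> \<open>The step \<open>e\<close> evaluated in \<open>S\<close>, its layer of \<Sigma>
    becoming a call to \<open>V\<close>.\<close>
  define u where "u = klift S (Y \<oplus> fob \<Sigma> V) (Y \<oplus> V)
      \<lbrace>eta S (Y \<oplus> V) \<cdot> Inl C Y V, tmap C S (Inr C Y V) \<cdot> \<upsilon> V\<rbrace> \<cdot> (\<sigma> (Y \<oplus> fob \<Sigma> V) \<cdot> e)"
  have u_typing [simp]: "u \<in> Arr C" "Dom C u = X" "Cod C u = tob S (Y \<oplus> V)"
    by (simp_all add: u_def S.tmap_eq)
  let ?j = "\<lbrace>eta S (Y \<oplus> V) \<cdot> Inl C Y V, u\<rbrace>"
  let ?m = "klift S ((Y \<oplus> X) \<oplus> V) (Y \<oplus> V) \<lbrace>?j, eta S (Y \<oplus> V) \<cdot> Inr C Y V\<rbrace> \<cdot> zeta (Y \<oplus> X)"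
  have "xi Y \<cdot> s = dagger S V Y ?m"
    unfolding xi_def
  proof (rule S.uniformity_law)
    show "zeta Y \<cdot> s = tmap C S (Id C Y \<oplus>\<^sub>a s) \<cdot> ?m"
      by (simp add: zeta_def out_s q_def u_def S.tmap_eq T.tmap_eq coprod_arr_def V)
  qed (simp_all add: hom_iff V)
  \<comment> \<open>The calls made by \<open>zeta (Y \<oplus> X)\<close> itself are solved first and
    give \<open>xi (Y \<oplus> X)\<close>; the calls made by \<open>u\<close> remain.\<close>
  also have "\<dots> = dagger S V Y (klift S (Y \<oplus> X) (Y \<oplus> V) ?j \<cdot> xi (Y \<oplus> X))"
    unfolding xi_def V by (rule S.dagger_klift) (simp_all add: hom_iff V)
  \<comment> \<open>The remaining loop alternates between \<open>xi (Y \<oplus> X)\<close> and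
    \<open>u\<close>; dinaturality starts it at \<open>X\<close> instead of \<open>V\<close>, and
    its body becomes \<open>xi (Y \<oplus> X) \<cdot> g\<close>.\<close>
  also have "\<dots> = klift S (Y \<oplus> X) Y \<lbrace>eta S Y,
      dagger S X Y (klift S (Y \<oplus> V) (Y \<oplus> X) \<lbrace>eta S (Y \<oplus> X) \<cdot> Inl C Y X, xi (Y \<oplus> X)\<rbrace> \<cdot> u)\<rbrace> \<cdot>
      xi (Y \<oplus> X)"
    by (rule S.dinaturality_law) (simp_all add: hom_iff V)
  also have "klift S (Y \<oplus> V) (Y \<oplus> X) \<lbrace>eta S (Y \<oplus> X) \<cdot> Inl C Y X, xi (Y \<oplus> X)\<rbrace> \<cdot> u =
      xi (Y \<oplus> X) \<cdot> g"
    by (simp add: g u_def K V S.tmap_eq)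
  finally have xi_s: "xi Y \<cdot> s =
      klift S (Y \<oplus> X) Y \<lbrace>eta S Y, dagger S X Y (xi (Y \<oplus> X) \<cdot> g)\<rbrace> \<cdot> xi (Y \<oplus> X)" .
  \<comment> \<open>The solution \<open>d\<close> is \<open>s\<close> at a bare leaf in
    \<open>X\<close>, so \<open>xi_s\<close> is evaluated there.\<close>
  have "xi Y \<cdot> d = xi Y \<cdot> (s \<cdot> (eta R (Y \<oplus> X) \<cdot> Inr C Y X))"
    by (simp add: s_def)
  also have "\<dots> = (klift S (Y \<oplus> X) Y \<lbrace>eta S Y, dagger S X Y (xi (Y \<oplus> X) \<cdot> g)\<rbrace> \<cdot> xi (Y \<oplus> X)) \<cdot>
      (eta R (Y \<oplus> X) \<cdot> Inr C Y X)"
    by (rule T.Comp_reassoc[OF xi_s]) (simp_all add: V)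
  also have "\<dots> = dagger S X Y (xi (Y \<oplus> X) \<cdot> g)"
    by (simp add: V)
  finally show ?thesis by (simp add: d_def)
qed

text \<open>Calls outside every layer of \<Sigma> form an iteration in \<open>T\<close>. Solving it
  in advance, through \<open>ext\<close> in \<open>R\<close> and through \<sigma> in
  \<open>S\<close>, leaves the guarded case.\<close>

lemma xi_dagger:
  assumes "g \<in> hom C X (tob R (Y \<oplus> X))"
  shows "dagger S X Y (xi (Y \<oplus> X) \<cdot> g) = xi Y \<cdot> dagger R X Y g"
proof -
  have g_typing [simp]: "g \<in> Arr C" "Dom C g = X" "Cod C g = tob R (Y \<oplus> X)"
    using assms by (simp_all add: hom_iff)
  let ?K = "fob \<Sigma> (tob R (Y \<oplus> X))"
  \<comment> \<open>The first layer of \<open>g\<close> regrouped: immediate calls to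
    \<open>X\<close> become the loop variable, results in \<open>Y\<close> and layers of \<Sigma>
    the exits.\<close>
  define g' where "g' = tmap C T \<lbrace>\<lbrace>Inl C (Y \<oplus> ?K) X \<cdot> Inl C Y ?K, Inr C (Y \<oplus> ?K) X\<rbrace>,
      Inl C (Y \<oplus> ?K) X \<cdot> Inr C Y ?K\<rbrace> \<cdot> (out (Y \<oplus> X) \<cdot> g)"
  have g': "g' \<in> hom C X (tob T ((Y \<oplus> ?K) \<oplus> X))"
    by (simp add: g'_def hom_iff T.tmap_eq)
  then have g'_typing [simp]: "g' \<in> Arr C" "Dom C g' = X" "Cod C g' = tob T ((Y \<oplus> ?K) \<oplus> X)"
    by (simp_all add: hom_iff)
  define j where "j = \<lbrace>eta R (Y \<oplus> X) \<cdot> Inl C Y X, guard (Y \<oplus> X)\<rbrace>"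
  have j_typing [simp]: "j \<in> Arr C" "Dom C j = Y \<oplus> ?K" "Cod C j = tob R (Y \<oplus> X)"
    by (simp_all add: j_def)
  have g_eq: "g = klift R ((Y \<oplus> ?K) \<oplus> X) (Y \<oplus> X) \<lbrace>j, eta R (Y \<oplus> X) \<cdot> Inr C Y X\<rbrace> \<cdot>
      (ext ((Y \<oplus> ?K) \<oplus> X) \<cdot> g')" (is "_ = ?rhs")
  proof (rule out_cancel[of _ X "Y \<oplus> X"])
    show "out (Y \<oplus> X) \<cdot> g = out (Y \<oplus> X) \<cdot> ?rhs"
      by (simp add: j_def g'_def T.tmap_eq)
  qed (simp_all add: hom_iff)
  let ?e = "dagger T X (Y \<oplus> ?K) g'"
  let ?g = "klift R (Y \<oplus> ?K) (Y \<oplus> X) j \<cdot> (ext (Y \<oplus> ?K) \<cdot> ?e)"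
  have "dagger R X Y g = dagger R X Y (klift R (Y \<oplus> ?K) (Y \<oplus> X) j \<cdot>
      dagger R X (Y \<oplus> ?K) (ext ((Y \<oplus> ?K) \<oplus> X) \<cdot> g'))"
    by (subst g_eq, rule R.dagger_klift) (simp_all add: hom_iff)
  also have "\<dots> = dagger R X Y ?g"
    by (simp only: dagger_ext[OF g'])
  finally have R: "dagger R X Y g = dagger R X Y ?g" .
  \<comment> \<open>The same reduction in \<open>S\<close>, with \<sigma> taking the place of
    \<open>ext\<close>.\<close>
  have "xi (Y \<oplus> X) \<cdot> g = klift S ((Y \<oplus> ?K) \<oplus> X) (Y \<oplus> X)
      \<lbrace>xi (Y \<oplus> X) \<cdot> j, eta S (Y \<oplus> X) \<cdot> Inr C Y X\<rbrace> \<cdot> (\<sigma> ((Y \<oplus> ?K) \<oplus> X) \<cdot> g')"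
    by (subst g_eq) simp
  then have "dagger S X Y (xi (Y \<oplus> X) \<cdot> g) = dagger S X Y (klift S (Y \<oplus> ?K) (Y \<oplus> X)
      (xi (Y \<oplus> X) \<cdot> j) \<cdot> dagger S X (Y \<oplus> ?K) (\<sigma> ((Y \<oplus> ?K) \<oplus> X) \<cdot> g'))"
    by (simp only:, intro S.dagger_klift) (simp_all add: hom_iff)
  also have "\<dots> = dagger S X Y (xi (Y \<oplus> X) \<cdot> ?g)"
    by (simp add: \<sigma>_dagger[OF g'])
  also have "\<dots> = xi Y \<cdot> dagger R X Y ?g"
    by (rule xi_dagger_guarded[of ?e]) (simp_all add: hom_iff j_def)
  finally show ?thesis by (simp only: R)
qed

lemma xi_morphism: "elgot_morphism C R S xi"
  unfolding elgot_morphism_def strong_nat_trans_def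
proof (intro conjI allI impI)
  fix X Y f
  assume "f \<in> hom C X Y"
  then show "fmap (functor_of C S) f \<cdot> xi X = xi Y \<cdot> fmap (functor_of C R) f"
    by (auto simp: hom_iff R.tmap_eq S.tmap_eq)
next
  fix X Y f
  assume "f \<in> hom C X (tob R Y)"
  then show "xi Y \<cdot> klift R X Y f = klift S X Y (xi Y \<cdot> f) \<cdot> xi X"
    by (rule xi_klift)
qed (simp_all add: hom_iff xi_str xi_dagger)

end

section \<open>The universal property\<close>

theorem theorem6p3:
  fixes C :: "('o, 'm) bicart" (structure)
    and T S :: "('o, 'm) elgot"
    and \<Sigma> :: "('o, 'm) sfunc"
    and V :: "'o \<Rightarrow> 'o"
    and out :: "'o \<Rightarrow> 'm"
    and d :: "'o \<Rightarrow> 'o \<Rightarrow> 'm \<Rightarrow> 'm"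
    and \<upsilon> \<sigma> :: "'o \<Rightarrow> 'm"
  assumes "distributive_category C"
    and "complete_elgot_monad C T"
    and "strong_functor C \<Sigma>"
    and "\<And>X. final_coalgebra C (resump_functor C T \<Sigma> X) (V X) (out X)"
    and "resump_iteration C T \<Sigma> V out d"
    and "complete_elgot_monad C S"
    and "strong_nat_trans C \<Sigma> (functor_of C S) \<upsilon>"
    and "elgot_morphism C T S \<sigma>"
  shows "(\<exists>!\<xi>. elgot_morphism C (resump_elgot C T \<Sigma> V out d) S \<xi> \<and>
               (\<forall>X. \<xi> X \<cdot> resump_ext C T \<Sigma> V out X = \<sigma> X) \<and>
               (\<forall>X. \<xi> X \<cdot> resump_iota C T \<Sigma> V out X = \<upsilon> X)) \<and>
         (\<forall>\<xi>. elgot_morphism C (resump_elgot C T \<Sigma> V out d) S \<xi> \<and>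
               (\<forall>X. \<xi> X \<cdot> resump_ext C T \<Sigma> V out X = \<sigma> X) \<and>
               (\<forall>X. \<xi> X \<cdot> resump_iota C T \<Sigma> V out X = \<upsilon> X) \<longrightarrow>
               (\<forall>X. \<xi> X = dagger S (V X) X (resump_zeta C \<Sigma> V out S \<upsilon> \<sigma> X)))"
proof -
  define R where "R = resump_elgot C T \<Sigma> V out d"
  have sel: "tob R = V" "eta R = resump_eta C T \<Sigma> V out" "klift R = resump_klift C T \<Sigma> V out"
    "tstr R = resump_str C T \<Sigma> V out" "dagger R = d"
    by (simp_all add: R_def resump_elgot_def)
  interpret T: complete_elgot_monad C T by fact
  interpret \<Sigma>: strong_functor C \<Sigma> by fact
  interpret S: complete_elgot_monad C S by fact
  interpret R: complete_elgot_monad C R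
    using assms(5) by (simp add: R_def resump_iteration_def)
  \<comment> \<open>The coalgebra facts come first in terms of \<open>V\<close>: they supply the
    equations that the next interpretation demands of \<open>R\<close>.\<close>
  interpret coalg: resumption_coalgebra C T \<Sigma> V out
    by unfold_locales (rule assms(4))
  interpret resumption_extension C T R S \<Sigma> out \<upsilon> \<sigma>
  proof unfold_locales
    show "out Y \<cdot> dagger R X Y f = tmap C T (Inl C Y (fob \<Sigma> (tob R Y))) \<cdot> dagger T X Y g"
      if "f \<in> hom C X (tob R (Y \<oplus> X))" "g \<in> hom C X (tob T (Y \<oplus> X))"
        "out (Y \<oplus> X) \<cdot> f = tmap C T (Inl C (Y \<oplus> X) (fob \<Sigma> (tob R (Y \<oplus> X)))) \<cdot> g" for X Y f g
      using assms(5) that unfolding resump_iteration_def sel by blast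
  qed (use assms coalg.resump_eta_char coalg.resump_klift_char coalg.resump_str_char in
      \<open>simp_all only: sel\<close>)
  have resump_ext: "resump_ext C T \<Sigma> V out X = ext X" for X
    by (simp add: resump_ext_def ext_def sel)
  have resump_iota: "resump_iota C T \<Sigma> V out X = guard X \<cdot> fmap \<Sigma> (eta R X)" for X
    using R.eta_typing[of X] by (simp add: resump_iota_def guard_def sel)
  have zeta: "resump_zeta C \<Sigma> V out S \<upsilon> \<sigma> X = zeta X" for X
    by (simp add: resump_zeta_def zeta_def sel)
  have xi: "dagger S (V X) X (zeta X) = xi X" for X
    by (simp add: xi_def sel)
  let ?P = "\<lambda>\<xi>. elgot_morphism C R S \<xi> \<and> (\<forall>X. \<xi> X \<cdot> ext X = \<sigma> X) \<and>
    (\<forall>X. \<xi> X \<cdot> (guard X \<cdot> fmap \<Sigma> (eta R X)) = \<upsilon> X)"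
  have unique: "\<xi> X = xi X" if "?P \<xi>" for \<xi> X
    using that by (intro morphism_eq_xi) auto
  have "\<exists>!\<xi>. ?P \<xi>"
  proof (rule ex1I)
    show "?P xi"
      using xi_morphism xi_ext xi_iota by blast
    show "\<xi> = xi" if "?P \<xi>" for \<xi>
      by (rule ext) (rule unique[OF that])
  qed
  moreover have "\<forall>\<xi>. ?P \<xi> \<longrightarrow> (\<forall>X. \<xi> X = xi X)"
    using unique by blast
  ultimately show ?thesis
    unfolding R_def[symmetric] resump_ext resump_iota zeta xi by (rule conjI)
qed

end
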